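(* Let $\mathbb F_q$ be a finite field, $\mathbf w=(w_0,\dots,w_n)$ a vector of positive integers, and let $P\in\mathbb P^n_{\mathbf w}(\mathbb F_q)$ be a rational point with support $S$. The set of $\mathbb F_q^\times$-orbits (for the weighted action) of representatives of $P$ in $\mathbb F_q^{n+1}\setminus\{0\}$ is naturally a torsor under $H^1(\mathbb F_q,\boldsymbol\mu_{k_S})$, where $k_S=\gcd\{w_i:i\in S\}$. Consequently the number of such orbits is $\gcd(k_S,q-1)$.
   Context: $\mathbb P^n_{\mathbf w}=\operatorname{Proj}\mathbb F_q[x_0,\dots,x_n]$ with $\deg x_i=w_i$. Its geometric points are the classes of $\overline{\mathbb F}_q^{\,n+1}\setminus\{0\}$ under $\lambda\cdot(x_0,\dots,x_n)=(\lambda^{w_0}x_0,\dots,\lambda^{w_n}x_n)$, $\lambda\in\overline{\mathbb F}_q^\times$; a point $P\in\mathbb P^n_{\mathbf w}(\mathbb F_q)$ is a Frobenius-invariant such class, and it always contains a vector in $\mathbb F_q^{n+1}\setminus\{0\}$. A representative of $P$ over $\mathbb F_q$ is such a vector; two of them are in the same $\mathbb F_q^\times$-orbit if they differ by the weighted action of some $\lambda\in\mathbb F_q^\times$. The support of $P$ is $\{i:x_i\neq0\}$ for any representative $x$. $\boldsymbol\mu_k$ is the group scheme of $k$-th roots of unity and $H^1$ is fppf cohomology; by Kummer theory $H^1(\mathbb F_q,\boldsymbol\mu_k)\cong\mathbb F_q^\times/(\mathbb F_q^\times)^k$. *)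

theory Defs
  imports "HOL-Algebra.Group_Action" "HOL-Algebra.Generated_Rings" "HOL-Algebra.Algebraic_Closure_Type" "HOL-Library.Cardinality"
begin

section \<open>Rational points of weighted projective space\<close>

text \<open>
  The finite field is a type \<open>'a\<close> of class \<open>{field, finite}\<close>, with \<open>q = CARD('a)\<close>; its algebraic
  closure is the type \<open>'a alg_closure\<close>, with embedding \<^const>\<open>to_ac\<close>. The \<open>n + 1\<close> coordinates are
  indexed by a finite type \<open>'n\<close>.
\<close>

definition wact :: "('n \<Rightarrow> nat) \<Rightarrow> 'b::field \<Rightarrow> ('n \<Rightarrow> 'b) \<Rightarrow> ('n \<Rightarrow> 'b)" where
  "wact w l x = (\<lambda>i. l ^ w i * x i)"

definition worbit :: "('n \<Rightarrow> nat) \<Rightarrow> ('n \<Rightarrow> 'b::field) \<Rightarrow> ('n \<Rightarrow> 'b) set" where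
  "worbit w x = {wact w l x |l. l \<noteq> 0}"

definition geometric_points :: "('n \<Rightarrow> nat) \<Rightarrow> ('n \<Rightarrow> 'a::field alg_closure) set set" where
  "geometric_points w = {worbit w x |x. x \<noteq> (\<lambda>_. 0)}"

definition frobenius :: "('n \<Rightarrow> 'a::{field,finite} alg_closure) \<Rightarrow> ('n \<Rightarrow> 'a alg_closure)" where
  "frobenius x = (\<lambda>i. x i ^ CARD('a))"

definition rational_points :: "('n \<Rightarrow> nat) \<Rightarrow> ('n \<Rightarrow> 'a::{field,finite} alg_closure) set set" where
  "rational_points w = {P \<in> geometric_points w. frobenius ` P = P}"

definition representatives ::
  "('n \<Rightarrow> 'a::{field,finite} alg_closure) set \<Rightarrow> ('n \<Rightarrow> 'a) set" where
  "representatives P = {x. x \<noteq> (\<lambda>_. 0) \<and> (\<lambda>i. to_ac (x i)) \<in> P}"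

definition rep_orbits ::
  "('n \<Rightarrow> nat) \<Rightarrow> ('n \<Rightarrow> 'a::{field,finite} alg_closure) set \<Rightarrow> ('n \<Rightarrow> 'a) set set" where
  "rep_orbits w P = {worbit w x |x. x \<in> representatives P}"

text \<open>All vectors in a geometric point have the same nonzero coordinates.\<close>

definition support :: "('n \<Rightarrow> 'b::field) set \<Rightarrow> 'n set" where
  "support P = {i. \<exists>x\<in>P. x i \<noteq> 0}"


section \<open>Algebras of finite type over the finite field\<close>

text \<open>
  \<open>emb\<close> is the structure map. An algebra of finite type over a finite field is countable, so
  every such algebra has an isomorphic copy whose carrier is a subset of \<^typ>\<open>nat\<close>.
\<close>

record 'a falg = "nat ring" +
  emb :: "'a \<Rightarrow> nat"

text \<open>As \<open>'a\<close> is finite, adding its image to a finite set of generators is harmless.\<close>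

definition fg_algebra :: "'a::{field,finite} falg \<Rightarrow> bool" where
  "fg_algebra R \<longleftrightarrow> cring R \<and> emb R \<in> ring_hom ring_of_type_algebra R \<and>
     (\<exists>E. finite E \<and> E \<subseteq> carrier R \<and> generate_ring R (range (emb R) \<union> E) = carrier R)"

text \<open>
  Homomorphisms are extensional, so that each one is a single HOL function;
  they are composed by \<open>compose (carrier R)\<close>.
\<close>

definition alg_hom :: "'a::{field,finite} falg \<Rightarrow> 'a falg \<Rightarrow> (nat \<Rightarrow> nat) set" where
  "alg_hom R T = {f \<in> ring_hom R T \<inter> extensional (carrier R). \<forall>a. f (emb R a) = emb T a}"


section \<open>The first fppf cohomology group of the roots of unity\<close>

text \<open>
  \<open>H\<^sup>1(\<bbbF>\<^sub>q, \<mu>\<^sub>k)\<close> is defined as fppf Cech cohomology in degree one, that is, as the direct limit over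
  all fppf coverings of \<open>Spec \<bbbF>\<^sub>q\<close> of the groups of 1-cocycles modulo 1-coboundaries
  (equivalently, as the group of isomorphism classes of fppf \<open>\<mu>\<^sub>k\<close>-torsors).

  Every fppf covering of \<open>Spec \<bbbF>\<^sub>q\<close> is refined by one of the form \<open>Spec R \<rightarrow> Spec \<bbbF>\<^sub>q\<close> with \<open>R\<close> a nonzero
  algebra of finite type. Conversely each such map is an fppf covering: over a field,
  nonzero algebras are faithfully flat and those of finite type are finitely presented.
\<close>

definition fppf_cover :: "'a::{field,finite} falg \<Rightarrow> bool" where
  "fppf_cover R \<longleftrightarrow> fg_algebra R \<and> \<one>\<^bsub>R\<^esub> \<noteq> \<zero>\<^bsub>R\<^esub>"

definition mu :: "nat \<Rightarrow> 'a::{field,finite} falg \<Rightarrow> nat set" where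
  "mu k T = {z \<in> carrier T. z [^]\<^bsub>T\<^esub> k = \<one>\<^bsub>T\<^esub>}"

text \<open>
  A 1-cochain for the covering \<open>U = Spec R\<close> is an element of \<open>\<mu>\<^sub>k(U \<times> U)\<close>, that is, a morphism of schemes
  \<open>U \<times> U \<rightarrow> \<mu>\<^sub>k\<close>. It is given here on points: a natural assignment, to every algebra \<open>T\<close> of finite type
  and every pair \<open>f, g : R \<rightarrow> T\<close> of \<open>T\<close>-valued points of \<open>U\<close>, of an element of \<open>\<mu>\<^sub>k(T)\<close>. By the Yoneda
  lemma this is the same as its value, in \<open>\<mu>\<^sub>k(R \<otimes> R)\<close>, at the two coprojections \<open>R \<rightarrow> R \<otimes> R\<close>.
  Values at other arguments are irrelevant; all of them occur in each cohomology class.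
\<close>

type_synonym 'a cochain = "'a falg \<Rightarrow> (nat \<Rightarrow> nat) \<Rightarrow> (nat \<Rightarrow> nat) \<Rightarrow> nat"

definition cocycles :: "nat \<Rightarrow> ('a::{field,finite} falg \<times> 'a cochain) set" where
  "cocycles k = {(R, \<zeta>). fppf_cover R \<and>
     (\<forall>T. fg_algebra T \<longrightarrow> (\<forall>f \<in> alg_hom R T. \<forall>g \<in> alg_hom R T. \<zeta> T f g \<in> mu k T)) \<and>
     (\<forall>T T'. fg_algebra T \<and> fg_algebra T' \<longrightarrow>
        (\<forall>h \<in> alg_hom T T'. \<forall>f \<in> alg_hom R T. \<forall>g \<in> alg_hom R T.
           h (\<zeta> T f g) = \<zeta> T' (compose (carrier R) h f) (compose (carrier R) h g))) \<and>
     (\<forall>T. fg_algebra T \<longrightarrow>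
        (\<forall>f \<in> alg_hom R T. \<forall>g \<in> alg_hom R T. \<forall>h \<in> alg_hom R T.
           \<zeta> T f g \<otimes>\<^bsub>T\<^esub> \<zeta> T g h = \<zeta> T f h))}"

text \<open>The coboundary of a unit \<open>b\<close> of \<open>R\<close>.\<close>

definition cobd :: "nat \<Rightarrow> 'a::{field,finite} cochain" where
  "cobd b = (\<lambda>T f g. g b \<otimes>\<^bsub>T\<^esub> inv\<^bsub>T\<^esub> (f b))"

text \<open>
  Equality in the direct limit: after pulling back to a common refinement \<open>Spec S\<close>, the two
  cocycles differ by the coboundary of an element of \<open>\<mu>\<^sub>k(S)\<close>.
\<close>

definition cohomologous ::
  "nat \<Rightarrow> (('a::{field,finite} falg \<times> 'a cochain) \<times> ('a falg \<times> 'a cochain)) set" where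
  "cohomologous k = {((R, \<zeta>), (R', \<zeta>')). (R, \<zeta>) \<in> cocycles k \<and> (R', \<zeta>') \<in> cocycles k \<and>
     (\<exists>S. fppf_cover S \<and> (\<exists>r \<in> alg_hom R S. \<exists>r' \<in> alg_hom R' S. \<exists>b \<in> mu k S.
        \<forall>T. fg_algebra T \<longrightarrow> (\<forall>f \<in> alg_hom S T. \<forall>g \<in> alg_hom S T.
          \<zeta>' T (compose (carrier R') f r') (compose (carrier R') g r') =
          \<zeta> T (compose (carrier R) f r) (compose (carrier R) g r) \<otimes>\<^bsub>T\<^esub> cobd b T f g)))}"

text \<open>
  Classes are multiplied by multiplying cocycles on a common covering; one exists because classes
  are closed under pullback to a refinement.
\<close>

definition H1_mu :: "nat \<Rightarrow> ('a::{field,finite} falg \<times> 'a cochain) set monoid" where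
  "H1_mu k = \<lparr>
     carrier = cocycles k // cohomologous k,
     monoid.mult = (\<lambda>c d. cohomologous k ``
               {(R, \<lambda>T f g. \<zeta> T f g \<otimes>\<^bsub>T\<^esub> \<eta> T f g) |R \<zeta> \<eta>. (R, \<zeta>) \<in> c \<and> (R, \<eta>) \<in> d}),
     one = cohomologous k `` {(R, \<lambda>T f g. \<one>\<^bsub>T\<^esub>) |R. fppf_cover R}\<rparr>"


section \<open>Torsors and the natural action on orbits\<close>

definition torsor :: "('g, 'm) monoid_scheme \<Rightarrow> 'e set \<Rightarrow> ('g \<Rightarrow> 'e \<Rightarrow> 'e) \<Rightarrow> bool" where
  "torsor G E \<phi> \<longleftrightarrow> group_action G E \<phi> \<and> E \<noteq> {} \<and>
     (\<forall>x\<in>E. \<forall>y\<in>E. \<exists>!g. g \<in> carrier G \<and> \<phi> g x = y)"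

text \<open>
  The action of \<open>H\<^sup>1\<close> is twisting of representatives. Representatives \<open>x\<close> and \<open>y\<close> over \<open>\<bbbF>\<^sub>q\<close> of the
  same point become equivalent over some covering \<open>Spec R\<close>, say \<open>y = \<lambda> \<cdot> x\<close> with \<open>\<lambda> \<in> R\<^sup>\<times>\<close>.
  The two pullbacks of \<open>\<lambda>\<close> to \<open>R \<otimes> R\<close> differ by an element of the stabilizer \<open>\<mu>\<^sub>k\<close> of \<open>x\<close>, which is a
  cocycle; it is the class of the torsor \<open>{\<lambda>. \<lambda> \<cdot> x = y}\<close>. A class \<open>c\<close> sends the orbit of \<open>x\<close> to the
  set of all \<open>y\<close> that arise with a cocycle in \<open>c\<close>.
\<close>

definition twist ::
  "('n \<Rightarrow> nat) \<Rightarrow> ('n \<Rightarrow> 'a::{field,finite} alg_closure) set \<Rightarrow>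
   ('a falg \<times> 'a cochain) set \<Rightarrow> ('n \<Rightarrow> 'a) set \<Rightarrow> ('n \<Rightarrow> 'a) set" where
  "twist w P c = (\<lambda>A \<in> rep_orbits w P.
     {y. \<exists>x \<in> A. \<exists>R l. fppf_cover R \<and> l \<in> Units R \<and>
        (\<forall>i. emb R (y i) = (l [^]\<^bsub>R\<^esub> w i) \<otimes>\<^bsub>R\<^esub> emb R (x i)) \<and> (R, cobd l) \<in> c})"

end

theory Submission
  imports Defs "HOL-Library.Countable_Set" "HOL-Number_Theory.Cong"
begin

text \<open>
  Fix a representative \<open>x\<close> of \<open>P\<close> over the finite field, and put \<open>c \<bullet> x = (c\<^bsup>w\<^sub>i/k\<^esup> x\<^sub>i)\<^sub>i\<close>. Since the
  numbers \<open>w\<^sub>i/k\<close>, for \<open>i\<close> in the support, have gcd 1, the representatives of \<open>P\<close> are the vectors \<open>c \<bullet> x\<close> for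
  a unique unit \<open>c\<close>, and \<open>l\<close> acts on them by multiplying \<open>c\<close> by \<open>l\<^sup>k\<close>. So the orbits form a torsor
  under the units modulo \<open>k\<close>-th powers.

  It remains to compute \<open>H\<^sup>1\<close> with this quotient. A cocycle \<open>\<zeta>\<close> on a covering \<open>Spec R\<close> is the coboundary of a
  unit \<open>b\<close> of \<open>R\<close>: as \<open>R\<close> is an algebra over a field, \<open>b\<close> is obtained directly by contracting \<open>\<zeta> \<in> R \<otimes> R\<close>
  with a linear functional, with no recourse to finite extensions or Galois cohomology. As \<open>\<zeta>\<^sup>k = 1\<close>,
  the element \<open>b\<^sup>k\<close> descends to a scalar \<open>a\<close>, and the class of \<open>\<zeta>\<close> corresponds to \<open>a\<close> modulo
  \<open>k\<close>-th powers. If \<open>y = l \<cdot> x\<close> with the coboundary of \<open>l\<close> in this class, then \<open>l\<^sup>k\<close> is \<open>a\<close> times a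
  \<open>k\<close>-th power, so twisting by the class is \<open>x \<mapsto> a \<bullet> x\<close> on orbits.
\<close>

section \<open>Algebras and linear functionals\<close>

text \<open>A covering is an arbitrary nonzero algebra of finite type and a cochain is a natural
  family over all algebras, so a cocycle can only be grasped through its value at the universal pair
  of points, in \<open>R \<otimes> R\<close>. This forces the construction of tensor products whose
  carriers are again sets of naturals. Comparing tensors through functionals turns the ring laws
  into identities in the second factor; the price is paid at the universal property, which needs
  dual systems for finitely many vectors. The same construction supplies common refinements of two
  coverings.

  The characteristic may divide \<open>k\<close>, and then k-th roots of unity in fields no longer
  determine the group scheme. For this reason the argument tracks units with scalar k-th power over
  arbitrary algebras. Every nonzero scalar \<open>a\<close> occurs, because it has a k-th root
  \<open>z\<close> in the algebraic closure and the subring generated by \<open>z\<close> is a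
  covering. The final count is a count of exponents of a primitive element.\<close>

locale fq_algebra = cring R for R :: "'a::{field,finite} falg" (structure) +
  assumes emb_hom: "emb R \<in> ring_hom ring_of_type_algebra R"
begin

lemma emb_closed [simp, intro]: "emb R a \<in> carrier R"
  using ring_hom_closed[OF emb_hom, of a] by (simp add: ring_of_type_algebra_def)

lemma emb_add: "emb R (a + b) = emb R a \<oplus> emb R b"
  using ring_hom_add[OF emb_hom, of a b] by (simp add: ring_of_type_algebra_def)

lemma emb_mult: "emb R (a * b) = emb R a \<otimes> emb R b"
  using ring_hom_mult[OF emb_hom, of a b] by (simp add: ring_of_type_algebra_def)

lemma emb_1 [simp]: "emb R 1 = \<one>"
  using ring_hom_one[OF emb_hom] by (simp add: ring_of_type_algebra_def)

lemma emb_0 [simp]: "emb R 0 = \<zero>"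
  using emb_add[of 0 0] by (metis add.l_cancel_one' add_0 emb_closed)

lemma emb_power: "emb R (a ^ n) = emb R a [^] n"
  by (induction n) (simp_all add: emb_mult m_comm)

lemma emb_Units: "a \<noteq> 0 \<Longrightarrow> emb R a \<in> Units R"
  unfolding Units_def
  by (auto intro!: bexI[of _ "emb R (inverse a)"] simp flip: emb_mult)

text \<open>A nonzero difference \<open>a - b\<close> would map to an element that is both zero and
  invertible. This is how identities checked over a covering come back to the base field.\<close>

lemma emb_eq_iff: "\<one> \<noteq> \<zero> \<Longrightarrow> emb R a = emb R b \<longleftrightarrow> a = b"
proof
  assume nz: "\<one> \<noteq> \<zero>" and eq: "emb R a = emb R b"
  show "a = b"
  proof (rule ccontr)
    assume "a \<noteq> b"
    have "emb R (a - b) \<oplus> emb R b = \<zero> \<oplus> emb R b"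
      using eq by (simp flip: emb_add)
    then have "emb R (a - b) = \<zero>"
      by (simp add: add.r_cancel)
    moreover have "emb R (a - b) \<otimes> emb R (inverse (a - b)) = \<one>"
      using \<open>a \<noteq> b\<close> by (simp flip: emb_mult)
    ultimately show False
      using nz by simp
  qed
qed simp

end

section \<open>Sums over lists, in which a summand may repeat, as in a list of pure tensors\<close>

definition lsum :: "('c, 'm) ring_scheme \<Rightarrow> ('b \<Rightarrow> 'c) \<Rightarrow> 'b list \<Rightarrow> 'c" where
  "lsum T h xs = foldr (\<lambda>x s. h x \<oplus>\<^bsub>T\<^esub> s) xs \<zero>\<^bsub>T\<^esub>"

lemma lsum_Nil [simp]: "lsum T h [] = \<zero>\<^bsub>T\<^esub>"
  and lsum_Cons [simp]: "lsum T h (x # xs) = h x \<oplus>\<^bsub>T\<^esub> lsum T h xs"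
  by (simp_all add: lsum_def)

lemma lsum_cong: "(\<And>x. x \<in> set xs \<Longrightarrow> h x = h' x) \<Longrightarrow> lsum T h xs = lsum T h' xs"
  by (induction xs) auto

lemma lsum_map: "lsum T h (map m xs) = lsum T (\<lambda>x. h (m x)) xs"
  by (induction xs) auto

context cring
begin

lemma lsum_closed [simp, intro]: "(\<And>x. x \<in> set xs \<Longrightarrow> h x \<in> carrier R) \<Longrightarrow> lsum R h xs \<in> carrier R"
  by (induction xs) auto

lemma lsum_append:
  "(\<And>x. x \<in> set xs \<union> set ys \<Longrightarrow> h x \<in> carrier R) \<Longrightarrow>
    lsum R h (xs @ ys) = lsum R h xs \<oplus> lsum R h ys"
  by (induction xs) (auto simp: a_assoc)

lemma lsum_concat:
  "(\<And>xs x. xs \<in> set xss \<Longrightarrow> x \<in> set xs \<Longrightarrow> h x \<in> carrier R) \<Longrightarrow>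
    lsum R h (concat xss) = lsum R (lsum R h) xss"
  proof (induction xss)
  case (Cons xs xss)
  then have "lsum R h (xs @ concat xss) = lsum R h xs \<oplus> lsum R h (concat xss)"
    by (intro lsum_append) auto
  moreover have "lsum R h (concat xss) = lsum R (lsum R h) xss"
    using Cons by (meson list.set_intros(2))
  ultimately show ?case by simp
qed auto

lemma lsum_zero: "lsum R (\<lambda>_. \<zero>) xs = \<zero>"
  by (induction xs) auto

lemma lsum_add:
  "(\<And>x. x \<in> set xs \<Longrightarrow> h x \<in> carrier R) \<Longrightarrow> (\<And>x. x \<in> set xs \<Longrightarrow> h' x \<in> carrier R) \<Longrightarrow>
    lsum R (\<lambda>x. h x \<oplus> h' x) xs = lsum R h xs \<oplus> lsum R h' xs"
proof (induction xs)
  case (Cons x xs)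
  have "h x \<oplus> h' x \<oplus> (lsum R h xs \<oplus> lsum R h' xs) =
        h x \<oplus> lsum R h xs \<oplus> (h' x \<oplus> lsum R h' xs)"
    if "h x \<in> carrier R" "h' x \<in> carrier R" "lsum R h xs \<in> carrier R" "lsum R h' xs \<in> carrier R"
    using that by algebra
  then show ?case
    using Cons by simp
qed auto

lemma lsum_ldistr:
  "c \<in> carrier R \<Longrightarrow> (\<And>x. x \<in> set xs \<Longrightarrow> h x \<in> carrier R) \<Longrightarrow>
    c \<otimes> lsum R h xs = lsum R (\<lambda>x. c \<otimes> h x) xs"
  by (induction xs) (auto simp: r_distr)

lemma lsum_rdistr:
  "c \<in> carrier R \<Longrightarrow> (\<And>x. x \<in> set xs \<Longrightarrow> h x \<in> carrier R) \<Longrightarrow>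
    lsum R h xs \<otimes> c = lsum R (\<lambda>x. h x \<otimes> c) xs"
  by (induction xs) (auto simp: l_distr)

lemma lsum_swap:
  "(\<And>x y. x \<in> set xs \<Longrightarrow> y \<in> set ys \<Longrightarrow> h x y \<in> carrier R) \<Longrightarrow>
    lsum R (\<lambda>x. lsum R (h x) ys) xs = lsum R (\<lambda>y. lsum R (\<lambda>x. h x y) xs) ys"
proof (induction xs)
  case Nil
  then show ?case by (simp add: lsum_zero)
next
  case (Cons x xs)
  then show ?case by (simp add: lsum_add)
qed

end

lemma ring_hom_lsum:
  assumes "h \<in> ring_hom R T" "cring R" "cring T" "\<And>x. x \<in> set xs \<Longrightarrow> m x \<in> carrier R"
  shows "h (lsum R m xs) = lsum T (\<lambda>x. h (m x)) xs"
proof -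
  interpret R: cring R by fact
  interpret T: cring T by fact
  show ?thesis
    using assms(4)
    by (induction xs)
      (auto simp: ring_hom_add[OF assms(1)] ring_hom_zero[OF assms(1)] R.ring_axioms T.ring_axioms)
qed

section \<open>Linear functionals on an algebra\<close>

definition dual :: "'a::{field,finite} falg \<Rightarrow> (nat \<Rightarrow> 'a) set" where
  "dual R = {l. (\<forall>x\<in>carrier R. \<forall>y\<in>carrier R. l (x \<oplus>\<^bsub>R\<^esub> y) = l x + l y) \<and>
                (\<forall>c. \<forall>x\<in>carrier R. l (emb R c \<otimes>\<^bsub>R\<^esub> x) = c * l x)}"

definition subspace_of :: "nat set \<Rightarrow> 'a::{field,finite} falg \<Rightarrow> bool" where
  "subspace_of W R \<longleftrightarrow> W \<subseteq> carrier R \<and> \<zero>\<^bsub>R\<^esub> \<in> W \<and> (\<forall>x\<in>W. \<forall>y\<in>W. x \<oplus>\<^bsub>R\<^esub> y \<in> W) \<and>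
     (\<forall>c. \<forall>x\<in>W. emb R c \<otimes>\<^bsub>R\<^esub> x \<in> W)"

lemma dual_add: "l \<in> dual R \<Longrightarrow> x \<in> carrier R \<Longrightarrow> y \<in> carrier R \<Longrightarrow> l (x \<oplus>\<^bsub>R\<^esub> y) = l x + l y"
  and dual_emb: "l \<in> dual R \<Longrightarrow> x \<in> carrier R \<Longrightarrow> l (emb R c \<otimes>\<^bsub>R\<^esub> x) = c * l x"
  by (auto simp: dual_def)

context fq_algebra
begin

lemma emb_uminus: "emb R (- a) = \<ominus> emb R a"
  by (rule minus_equality[symmetric]) (simp_all flip: emb_add)

lemma emb_uminus_mult: "x \<in> carrier R \<Longrightarrow> emb R (- a) \<otimes> x = \<ominus> (emb R a \<otimes> x)"
  by (simp add: emb_uminus l_minus)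

text \<open>Functionals are closed under the transpose of multiplication by \<open>r\<close>. This
  is what makes products of tensors compatible with contraction.\<close>

lemma dual_mult: "l \<in> dual R \<Longrightarrow> r \<in> carrier R \<Longrightarrow> (\<lambda>x. l (r \<otimes> x)) \<in> dual R"
  proof -
  assume l: "l \<in> dual R" and r: "r \<in> carrier R"
  have "l (r \<otimes> (emb R c \<otimes> x)) = c * l (r \<otimes> x)" if "x \<in> carrier R" for c x
    using dual_emb[OF l, of "r \<otimes> x" c] m_lcomm[of r "emb R c" x] that r by simp
  then show ?thesis
    using dual_add[OF l] r by (auto simp: dual_def r_distr)
qed

text \<open>By Zorn there is a subspace \<open>M\<close> containing \<open>W\<close> that is maximal
  among those avoiding \<open>d\<close>. It is a hyperplane complementary to the line of
  \<open>d\<close>, and the functional reads off the coefficient of \<open>d\<close>.\<close>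

lemma ex_dual_separating:
  assumes W: "subspace_of W R" and d: "d \<in> carrier R" "d \<notin> W"
  obtains l where "l \<in> dual R" "\<And>x. x \<in> W \<Longrightarrow> l x = 0" "l d = 1"
proof -
  define \<A> where "\<A> = {V. subspace_of V R \<and> W \<subseteq> V \<and> d \<notin> V}"
  have "\<exists>M\<in>\<A>. \<forall>V\<in>\<A>. M \<subseteq> V \<longrightarrow> V = M"
  proof (rule subset_Zorn_nonempty)
    show "\<A> \<noteq> {}"
      using W d by (auto simp: \<A>_def)
    fix \<C> assume ne: "\<C> \<noteq> {}" and ch: "subset.chain \<A> \<C>"
    then have sub: "\<C> \<subseteq> \<A>" and tot: "\<And>V Y. V \<in> \<C> \<Longrightarrow> Y \<in> \<C> \<Longrightarrow> V \<subseteq> Y \<or> Y \<subseteq> V"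
      by (auto simp: subset.chain_def)
    have "x \<oplus> y \<in> \<Union>\<C>" if xy: "x \<in> \<Union>\<C>" "y \<in> \<Union>\<C>" for x y
    proof -
      obtain V Y where VY: "V \<in> \<C>" "Y \<in> \<C>" "x \<in> V" "y \<in> Y"
        using xy by blast
      then obtain U where U: "U \<in> \<C>" "x \<in> U" "y \<in> U"
        using tot by blast
      then have "subspace_of U R" using sub by (auto simp: \<A>_def)
      then have "x \<oplus> y \<in> U" using U by (auto simp: subspace_of_def)
      then show ?thesis using U by auto
    qed
    moreover have "\<Union>\<C> \<subseteq> carrier R" "\<zero> \<in> \<Union>\<C>" "W \<subseteq> \<Union>\<C>" "d \<notin> \<Union>\<C>"
      using sub ne by (auto simp: \<A>_def subspace_of_def)
    moreover have "emb R c \<otimes> x \<in> \<Union>\<C>" if "x \<in> \<Union>\<C>" for c x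
      using sub that by (fastforce simp: \<A>_def subspace_of_def)
    ultimately show "\<Union>\<C> \<in> \<A>"
      by (auto simp: \<A>_def subspace_of_def)
  qed
  then obtain M where M: "subspace_of M R" "W \<subseteq> M" "d \<notin> M"
    and max: "\<And>V. subspace_of V R \<Longrightarrow> M \<subseteq> V \<Longrightarrow> d \<notin> V \<Longrightarrow> V = M"
    unfolding \<A>_def by (auto 0 4)
  have Mc: "x \<in> carrier R" if "x \<in> M" for x
    using M(1) that by (auto simp: subspace_of_def)
  have Madd: "x \<oplus> y \<in> M" if "x \<in> M" "y \<in> M" for x y
    using M(1) that by (auto simp: subspace_of_def)
  have Msm: "emb R c \<otimes> x \<in> M" if "x \<in> M" for x c
    using M(1) that by (auto simp: subspace_of_def)
  have Mneg: "\<ominus> x \<in> M" if "x \<in> M" for x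
    using Msm[OF that, of "-1"] that Mc[OF that] emb_uminus_mult[of x 1] by simp
  \<comment> \<open>If \<open>x\<close> is outside \<open>M\<close>, then \<open>M\<close> enlarged
    by the line of \<open>x\<close> contains \<open>d\<close> by maximality. There the coefficient
    of \<open>x\<close> is nonzero, since \<open>d\<close> is not in \<open>M\<close>, so the
    equation can be solved for \<open>x\<close>.\<close>
  have ex: "\<exists>c. \<exists>m\<in>M. x = m \<oplus> emb R c \<otimes> d" if x: "x \<in> carrier R" for x
  proof (cases "x \<in> M")
    case True
    then show ?thesis using d Mc by (intro exI[of _ "0::'a"] bexI[of _ x]) auto
  next
    case False
    define V where "V = {m \<oplus> emb R c \<otimes> x |m c. m \<in> M}"
    have "subspace_of V R"
      unfolding subspace_of_def
    proof (intro conjI ballI allI)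
      show "V \<subseteq> carrier R" using Mc x by (auto simp: V_def)
      have "\<zero> \<in> M" using M(1) by (auto simp: subspace_of_def)
      then show "\<zero> \<in> V" using x unfolding V_def by (auto intro!: exI[of _ \<zero>] exI[of _ "0::'a"])
    next
      fix y z assume "y \<in> V" "z \<in> V"
      then obtain m c m' c' where *: "y = m \<oplus> emb R c \<otimes> x" "z = m' \<oplus> emb R c' \<otimes> x" "m \<in> M" "m' \<in> M"
        by (auto simp: V_def)
      have "emb R c \<in> carrier R" "emb R c' \<in> carrier R" by auto
      then have "y \<oplus> z = (m \<oplus> m') \<oplus> emb R (c + c') \<otimes> x"
        unfolding * emb_add using Mc[OF *(3)] Mc[OF *(4)] x by algebra
      then show "y \<oplus> z \<in> V"
        using Madd * unfolding V_def by blast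
    next
      fix c y assume "y \<in> V"
      then obtain m c' where *: "y = m \<oplus> emb R c' \<otimes> x" "m \<in> M"
        by (auto simp: V_def)
      have "emb R c \<otimes> y = emb R c \<otimes> m \<oplus> emb R (c * c') \<otimes> x"
        unfolding * using Mc[OF *(2)] x by (simp add: r_distr emb_mult m_assoc)
      then show "emb R c \<otimes> y \<in> V"
        using Msm * unfolding V_def by blast
    qed
    moreover have "M \<subseteq> V"
    proof
      fix m assume "m \<in> M"
      then show "m \<in> V"
        using x Mc unfolding V_def by (auto intro!: exI[of _ m] exI[of _ "0::'a"])
    qed
    moreover have "x \<in> V"
      using M(1) x unfolding V_def by (auto simp: subspace_of_def intro!: exI[of _ \<zero>] exI[of _ "1::'a"])
    ultimately have "d \<in> V"
      using max False by blast
    then obtain m c where dm: "d = m \<oplus> emb R c \<otimes> x" "m \<in> M"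
      by (auto simp: V_def)
    then have "c \<noteq> 0"
      using M(3) x Mc by auto
    have "emb R (inverse c) \<otimes> d = emb R (inverse c) \<otimes> m \<oplus> emb R (inverse c * c) \<otimes> x"
      unfolding dm using Mc[OF dm(2)] x by (simp add: r_distr emb_mult m_assoc)
    then have "x = \<ominus> (emb R (inverse c) \<otimes> m) \<oplus> emb R (inverse c) \<otimes> d"
      using \<open>c \<noteq> 0\<close> Mc[OF dm(2)] x by (simp add: r_neg1)
    then show ?thesis
      using Mneg Msm dm(2) by blast
  qed
  \<comment> \<open>Two different coefficients would put a nonzero multiple of \<open>d\<close>,
    hence \<open>d\<close> itself, into \<open>M\<close>.\<close>
  have uniq: "c = c'" if "m \<in> M" "m' \<in> M" "m \<oplus> emb R c \<otimes> d = m' \<oplus> emb R c' \<otimes> d" for m m' c c'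
  proof (rule ccontr)
    assume "c \<noteq> c'"
    have cl: "emb R c \<in> carrier R" "emb R c' \<in> carrier R" by auto
    have "emb R (c - c') \<otimes> d = emb R c \<otimes> d \<ominus> emb R c' \<otimes> d"
      using emb_add[of c "-c'"] d by (simp add: emb_uminus l_distr l_minus minus_eq)
    also have "\<dots> = (m \<oplus> emb R c \<otimes> d) \<ominus> m \<ominus> emb R c' \<otimes> d"
      using Mc[OF that(1)] d cl by algebra
    also have "\<dots> = m' \<ominus> m"
      unfolding that(3) using Mc[OF that(1)] Mc[OF that(2)] d cl by algebra
    finally have "emb R (c - c') \<otimes> d \<in> M"
      using Madd Mneg that by (simp add: minus_eq)
    then have "emb R (inverse (c - c')) \<otimes> (emb R (c - c') \<otimes> d) \<in> M"
      by (rule Msm)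
    moreover have "emb R (inverse (c - c')) \<otimes> (emb R (c - c') \<otimes> d) = emb R (inverse (c - c') * (c - c')) \<otimes> d"
      using d by (simp add: emb_mult m_assoc)
    ultimately show False
      using M(3) d \<open>c \<noteq> c'\<close> by simp
  qed
  define l where "l x = (SOME c. \<exists>m\<in>M. x = m \<oplus> emb R c \<otimes> d)" for x
  have l: "l x = c" if "x = m \<oplus> emb R c \<otimes> d" "m \<in> M" for x m c
  proof -
    have "\<exists>c. \<exists>m\<in>M. x = m \<oplus> emb R c \<otimes> d" using that by blast
    from someI_ex[OF this] show ?thesis
      using that uniq unfolding l_def by blast
  qed
  show ?thesis
  proof
    show "l \<in> dual R"
      unfolding dual_def
    proof (intro CollectI conjI ballI allI)
      fix x y assume "x \<in> carrier R" "y \<in> carrier R"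
      then obtain m c m' c' where *: "x = m \<oplus> emb R c \<otimes> d" "y = m' \<oplus> emb R c' \<otimes> d" "m \<in> M" "m' \<in> M"
        using ex by meson
      have "emb R c \<in> carrier R" "emb R c' \<in> carrier R" by auto
      then have "x \<oplus> y = (m \<oplus> m') \<oplus> emb R (c + c') \<otimes> d"
        unfolding * emb_add using Mc[OF *(3)] Mc[OF *(4)] d by algebra
      then show "l (x \<oplus> y) = l x + l y"
        using l * Madd by metis
    next
      fix c x assume "x \<in> carrier R"
      then obtain m c' where *: "x = m \<oplus> emb R c' \<otimes> d" "m \<in> M"
        using ex by meson
      have "emb R c \<otimes> x = emb R c \<otimes> m \<oplus> emb R (c * c') \<otimes> d"
        unfolding * using Mc[OF *(2)] d by (simp add: r_distr emb_mult m_assoc)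
      then show "l (emb R c \<otimes> x) = c * l x"
        using l * Msm by metis
    qed
    show "l x = 0" if "x \<in> W" for x
      by (rule l[of _ x]) (use that M(2) Mc d in auto)
    show "l d = 1"
      by (rule l[of _ \<zero>]) (use M(1) d in \<open>auto simp: subspace_of_def\<close>)
  qed
qed

lemma subspace_zero: "subspace_of {\<zero>} R"
  by (auto simp: subspace_of_def)

text \<open>A finite dual system, built without bases. The list found for \<open>V\<close> defines a
  linear map \<open>\<pi>\<close> whose fixed space contains \<open>V\<close>. If it does not fix
  \<open>y\<close>, take a functional that vanishes on the fixed space and is 1 at \<open>y\<close>;
  the extra pair \<open>(l, y - \<pi> y)\<close> corrects the value at \<open>y\<close> and changes
  nothing on \<open>V\<close>.\<close>

lemma finite_dual_expansion:
  assumes "finite V" "V \<subseteq> carrier R"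
  shows "\<exists>bs. set bs \<subseteq> dual R \<times> carrier R \<and>
           (\<forall>x\<in>V. x = lsum R (\<lambda>(l, b). emb R (l x) \<otimes> b) bs)"
  using assms
proof (induction V)
  case empty
  then show ?case by (intro exI[of _ "[]"]) auto
next
  case (insert y V)
  then obtain bs where bs: "set bs \<subseteq> dual R \<times> carrier R"
    "\<And>x. x \<in> V \<Longrightarrow> x = lsum R (\<lambda>(l, b). emb R (l x) \<otimes> b) bs"
    by auto
  define \<pi> where "\<pi> x = lsum R (\<lambda>(l, b). emb R (l x) \<otimes> b) bs" for x
  have bsc: "(case p of (l, b) \<Rightarrow> emb R (l x) \<otimes> b) \<in> carrier R" if "p \<in> set bs" for p x
    using bs(1) that by auto
  have \<pi>c: "\<pi> x \<in> carrier R" for x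
    unfolding \<pi>_def by (rule lsum_closed) (rule bsc)
  have \<pi>_add: "\<pi> (x \<oplus> z) = \<pi> x \<oplus> \<pi> z" if "x \<in> carrier R" "z \<in> carrier R" for x z
  proof -
    have "\<pi> (x \<oplus> z) = lsum R (\<lambda>p. (case p of (l, b) \<Rightarrow> emb R (l x) \<otimes> b) \<oplus> (case p of (l, b) \<Rightarrow> emb R (l z) \<otimes> b)) bs"
      unfolding \<pi>_def using bs(1) that
      by (intro lsum_cong) (auto simp: dual_add emb_add l_distr)
    then show ?thesis
      unfolding \<pi>_def by (simp add: lsum_add bsc)
  qed
  have \<pi>_emb: "\<pi> (emb R c \<otimes> x) = emb R c \<otimes> \<pi> x" if "x \<in> carrier R" for c x
  proof -
    have "\<pi> (emb R c \<otimes> x) = lsum R (\<lambda>p. emb R c \<otimes> (case p of (l, b) \<Rightarrow> emb R (l x) \<otimes> b)) bs"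
      unfolding \<pi>_def using bs(1) that
      by (intro lsum_cong) (auto simp: dual_emb emb_mult m_assoc)
    then show ?thesis
      unfolding \<pi>_def by (simp add: lsum_ldistr bsc)
  qed
  define W where "W = {x \<in> carrier R. \<pi> x = x}"
  have W: "subspace_of W R"
    unfolding subspace_of_def W_def
    using \<pi>_add \<pi>_emb \<pi>_emb[of \<zero> 0] \<pi>c by auto
  have XW: "V \<subseteq> W"
    using bs(2) insert.prems by (auto simp: W_def \<pi>_def)
  have yc: "y \<in> carrier R" using insert.prems by auto
  show ?case
  proof (cases "y \<in> W")
    case True
    then show ?thesis
      using bs by (intro exI[of _ bs]) (auto simp: W_def \<pi>_def)
  next
    case False
    obtain l where l: "l \<in> dual R" "\<And>x. x \<in> W \<Longrightarrow> l x = 0" "l y = 1"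
      using ex_dual_separating[OF W yc False] by blast
    have "y = (y \<ominus> \<pi> y) \<oplus> \<pi> y"
      using yc \<pi>c[of y] by algebra
    moreover have "\<pi> x = x" "l x = 0" if "x \<in> V" for x
      using XW l(2) that by (auto simp: W_def)
    ultimately have "\<forall>x\<in>insert y V. x = lsum R (\<lambda>(l, b). emb R (l x) \<otimes> b) ((l, y \<ominus> \<pi> y) # bs)"
      unfolding lsum_Cons \<pi>_def[symmetric] using l(3) yc \<pi>c[of y] insert.prems by auto
    then show ?thesis
      using bs(1) l(1) yc \<pi>c[of y] by (intro exI[of _ "(l, y \<ominus> \<pi> y) # bs"]) auto
  qed
qed

end

section \<open>Homomorphisms of algebras\<close>

context
  fixes R T :: "'a::{field,finite} falg"
  assumes R: "fq_algebra R" and T: "fq_algebra T"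
begin

interpretation R: fq_algebra R by (fact R)
interpretation T: fq_algebra T by (fact T)

lemma alg_hom_closed: "f \<in> alg_hom R T \<Longrightarrow> x \<in> carrier R \<Longrightarrow> f x \<in> carrier T"
  and alg_hom_add: "f \<in> alg_hom R T \<Longrightarrow> x \<in> carrier R \<Longrightarrow> y \<in> carrier R \<Longrightarrow> f (x \<oplus>\<^bsub>R\<^esub> y) = f x \<oplus>\<^bsub>T\<^esub> f y"
  and alg_hom_mult: "f \<in> alg_hom R T \<Longrightarrow> x \<in> carrier R \<Longrightarrow> y \<in> carrier R \<Longrightarrow> f (x \<otimes>\<^bsub>R\<^esub> y) = f x \<otimes>\<^bsub>T\<^esub> f y"
  and alg_hom_one: "f \<in> alg_hom R T \<Longrightarrow> f \<one>\<^bsub>R\<^esub> = \<one>\<^bsub>T\<^esub>"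
  and alg_hom_zero: "f \<in> alg_hom R T \<Longrightarrow> f \<zero>\<^bsub>R\<^esub> = \<zero>\<^bsub>T\<^esub>"
  and alg_hom_emb: "f \<in> alg_hom R T \<Longrightarrow> f (emb R a) = emb T a"
  by (auto simp: alg_hom_def ring_hom_closed ring_hom_add ring_hom_mult ring_hom_one
      intro: ring_hom_zero R.ring_axioms T.ring_axioms)

lemma alg_hom_power: "f \<in> alg_hom R T \<Longrightarrow> x \<in> carrier R \<Longrightarrow> f (x [^]\<^bsub>R\<^esub> (n::nat)) = f x [^]\<^bsub>T\<^esub> n"
  by (induction n) (auto simp: alg_hom_one alg_hom_mult)

lemma alg_hom_Units:
  assumes "f \<in> alg_hom R T" "x \<in> Units R"
  shows "f x \<in> Units T"
proof -
  have "inv\<^bsub>R\<^esub> x \<in> carrier R" "x \<in> carrier R" "x \<otimes>\<^bsub>R\<^esub> inv\<^bsub>R\<^esub> x = \<one>\<^bsub>R\<^esub>"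
    using assms(2) by auto
  then show ?thesis
    using alg_hom_mult[OF assms(1), of x "inv\<^bsub>R\<^esub> x"] alg_hom_closed[OF assms(1)] alg_hom_one[OF assms(1)]
      T.m_comm
    unfolding Units_def by (auto intro!: bexI[of _ "f (inv\<^bsub>R\<^esub> x)"])
qed

lemma alg_hom_lsum:
  "f \<in> alg_hom R T \<Longrightarrow> (\<And>x. x \<in> set xs \<Longrightarrow> m x \<in> carrier R) \<Longrightarrow>
    f (lsum R m xs) = lsum T (\<lambda>x. f (m x)) xs"
  by (rule ring_hom_lsum) (auto simp: alg_hom_def R.is_cring T.is_cring)

lemma alg_homI:
  assumes "\<And>x. x \<in> carrier R \<Longrightarrow> f x \<in> carrier T"
    and "\<And>x y. x \<in> carrier R \<Longrightarrow> y \<in> carrier R \<Longrightarrow> f (x \<oplus>\<^bsub>R\<^esub> y) = f x \<oplus>\<^bsub>T\<^esub> f y"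
    and "\<And>x y. x \<in> carrier R \<Longrightarrow> y \<in> carrier R \<Longrightarrow> f (x \<otimes>\<^bsub>R\<^esub> y) = f x \<otimes>\<^bsub>T\<^esub> f y"
    and "\<And>a. f (emb R a) = emb T a"
    and "f \<in> extensional (carrier R)"
  shows "f \<in> alg_hom R T"
  using assms assms(4)[of 1] by (auto simp: alg_hom_def intro!: ring_hom_memI)

text \<open>Carries generators of the two factors into their tensor product, which shows that it is
  of finite type.\<close>

lemma alg_hom_generate_ring:
  assumes "f \<in> alg_hom R T" "H \<subseteq> carrier R" "f ` H \<subseteq> G" "x \<in> generate_ring R H"
  shows "f x \<in> generate_ring T G"
  using assms(4)
proof induction
  case one
  then show ?case using alg_hom_one[OF assms(1)] by (simp add: generate_ring.one)
next
  case (incl h)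
  then show ?case using assms(3) by (auto intro: generate_ring.incl)
next
  case (a_inv h)
  then have "h \<in> carrier R"
    using R.generate_ring_in_carrier[OF assms(2)] by auto
  then have "f (\<ominus>\<^bsub>R\<^esub> h) \<oplus>\<^bsub>T\<^esub> f h = \<zero>\<^bsub>T\<^esub>"
    using alg_hom_add[OF assms(1), of "\<ominus>\<^bsub>R\<^esub> h" h] alg_hom_zero[OF assms(1)] by (simp add: R.l_neg)
  then have "f (\<ominus>\<^bsub>R\<^esub> h) = \<ominus>\<^bsub>T\<^esub> f h"
    using T.minus_equality[of "f (\<ominus>\<^bsub>R\<^esub> h)" "f h"] alg_hom_closed[OF assms(1)] \<open>h \<in> carrier R\<close> by simp
  then show ?case using a_inv by (simp add: generate_ring.a_inv)
next
  case (eng_add h1 h2)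
  then show ?case
    using R.generate_ring_in_carrier[OF assms(2)] alg_hom_add[OF assms(1)]
    by (simp add: generate_ring.eng_add)
next
  case (eng_mult h1 h2)
  then show ?case
    using R.generate_ring_in_carrier[OF assms(2)] alg_hom_mult[OF assms(1)]
    by (simp add: generate_ring.eng_mult)
qed

end

lemma alg_hom_compose:
  assumes "fq_algebra R" "fq_algebra S" "fq_algebra T" "f \<in> alg_hom R S" "g \<in> alg_hom S T"
  shows "compose (carrier R) g f \<in> alg_hom R T"
proof -
  interpret R: fq_algebra R by fact
  show ?thesis
  using assms(1-3)
  by (intro alg_homI)
    (auto simp: compose_def alg_hom_closed[OF assms(1,2,4)] alg_hom_closed[OF assms(2,3,5)]
      alg_hom_add[OF assms(1,2,4)] alg_hom_add[OF assms(2,3,5)] alg_hom_mult[OF assms(1,2,4)]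
      alg_hom_mult[OF assms(2,3,5)] alg_hom_emb[OF assms(1,2,4)] alg_hom_emb[OF assms(2,3,5)])
qed

lemma fg_algebra_imp_fq_algebra: "fg_algebra R \<Longrightarrow> fq_algebra R"
  by (simp add: fg_algebra_def fq_algebra_def fq_algebra_axioms_def)

section \<open>Tensor products\<close>

text \<open>
  An element of \<open>R \<otimes> T\<close> is represented by a list of pairs, standing for a sum of pure tensors. Two
  lists are identified if they agree after contracting the first factor with every linear
  functional. As lists of pairs are countable, the classes can be coded by natural numbers.
\<close>

definition contract :: "'a::{field,finite} falg \<Rightarrow> (nat \<Rightarrow> 'a) \<Rightarrow> (nat \<times> nat) list \<Rightarrow> nat" where
  "contract T l p = lsum T (\<lambda>(r, a). emb T (l r) \<otimes>\<^bsub>T\<^esub> a) p"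

definition tlists :: "'a::{field,finite} falg \<Rightarrow> 'a falg \<Rightarrow> (nat \<times> nat) list set" where
  "tlists R T = {p. \<forall>x\<in>set p. fst x \<in> carrier R \<and> snd x \<in> carrier T}"

definition teq :: "'a::{field,finite} falg \<Rightarrow> 'a falg \<Rightarrow> (nat \<times> nat) list \<Rightarrow> (nat \<times> nat) list \<Rightarrow> bool" where
  "teq R T p p' \<longleftrightarrow> (\<forall>l\<in>dual R. contract T l p = contract T l p')"

text \<open>The chosen list depends on \<open>p\<close> only through its class, since equivalent
  lists satisfy the same predicate. So its code is a code of the class, and decoding returns a
  representative to compute with.\<close>

definition trep :: "'a::{field,finite} falg \<Rightarrow> 'a falg \<Rightarrow> (nat \<times> nat) list \<Rightarrow> (nat \<times> nat) list" where
  "trep R T p = (SOME p'. p' \<in> tlists R T \<and> teq R T p p')"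

definition tcls :: "'a::{field,finite} falg \<Rightarrow> 'a falg \<Rightarrow> (nat \<times> nat) list \<Rightarrow> nat" where
  "tcls R T p = to_nat (trep R T p)"

definition tmult ::
  "'a::{field,finite} falg \<Rightarrow> 'a falg \<Rightarrow> (nat \<times> nat) list \<Rightarrow> (nat \<times> nat) list \<Rightarrow> (nat \<times> nat) list" where
  "tmult R T p p' = concat (map (\<lambda>(r, a). map (\<lambda>(s, b). (r \<otimes>\<^bsub>R\<^esub> s, a \<otimes>\<^bsub>T\<^esub> b)) p') p)"

definition tensor :: "'a::{field,finite} falg \<Rightarrow> 'a falg \<Rightarrow> 'a falg" where
  "tensor R T = \<lparr>carrier = tcls R T ` tlists R T,
     monoid.mult = (\<lambda>m n. tcls R T (tmult R T (from_nat m) (from_nat n))),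
     one = tcls R T [(\<one>\<^bsub>R\<^esub>, \<one>\<^bsub>T\<^esub>)],
     zero = tcls R T [],
     add = (\<lambda>m n. tcls R T (from_nat m @ from_nat n)),
     emb = (\<lambda>c. tcls R T [(emb R c, \<one>\<^bsub>T\<^esub>)])\<rparr>"

definition in1 :: "'a::{field,finite} falg \<Rightarrow> 'a falg \<Rightarrow> nat \<Rightarrow> nat" where
  "in1 R T = (\<lambda>r\<in>carrier R. tcls R T [(r, \<one>\<^bsub>T\<^esub>)])"

definition in2 :: "'a::{field,finite} falg \<Rightarrow> 'a falg \<Rightarrow> nat \<Rightarrow> nat" where
  "in2 R T = (\<lambda>a\<in>carrier T. tcls R T [(\<one>\<^bsub>R\<^esub>, a)])"

context
  fixes R T :: "'a::{field,finite} falg"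
  assumes R: "fq_algebra R" and T: "fq_algebra T"
begin

interpretation R: fq_algebra R by (fact R)
interpretation T: fq_algebra T by (fact T)

lemma tlists_Nil [simp]: "[] \<in> tlists R T"
  and tlists_Cons [simp]: "x # p \<in> tlists R T \<longleftrightarrow> fst x \<in> carrier R \<and> snd x \<in> carrier T \<and> p \<in> tlists R T"
  and tlists_append [simp]: "p @ p' \<in> tlists R T \<longleftrightarrow> p \<in> tlists R T \<and> p' \<in> tlists R T"
  by (auto simp: tlists_def)

lemma tlistsD: "p \<in> tlists R T \<Longrightarrow> x \<in> set p \<Longrightarrow> fst x \<in> carrier R \<and> snd x \<in> carrier T"
  by (auto simp: tlists_def)

lemma tlistsI: "(\<And>x. x \<in> set p \<Longrightarrow> fst x \<in> carrier R \<and> snd x \<in> carrier T) \<Longrightarrow> p \<in> tlists R T"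
  by (simp add: tlists_def)

lemma tmult_closed: "p \<in> tlists R T \<Longrightarrow> p' \<in> tlists R T \<Longrightarrow> tmult R T p p' \<in> tlists R T"
  by (fastforce simp: tmult_def dest: tlistsD intro: tlistsI)

lemma contract_closed [simp]: "p \<in> tlists R T \<Longrightarrow> contract T l p \<in> carrier T"
  unfolding contract_def by (rule T.lsum_closed) (auto dest: tlistsD)

lemma contract_append:
  "p \<in> tlists R T \<Longrightarrow> p' \<in> tlists R T \<Longrightarrow> contract T l (p @ p') = contract T l p \<oplus>\<^bsub>T\<^esub> contract T l p'"
  unfolding contract_def by (rule T.lsum_append) (auto dest: tlistsD)

lemma lsum_tmult:
  assumes "cring U" "p \<in> tlists R T" "p' \<in> tlists R T"
    "\<And>r a. r \<in> carrier R \<Longrightarrow> a \<in> carrier T \<Longrightarrow> h (r, a) \<in> carrier U"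
  shows "lsum U h (tmult R T p p') =
    lsum U (\<lambda>(r, a). lsum U (\<lambda>(s, b). h (r \<otimes>\<^bsub>R\<^esub> s, a \<otimes>\<^bsub>T\<^esub> b)) p') p"
proof -
  interpret U: cring U by fact
  show ?thesis
    unfolding tmult_def
    by (subst U.lsum_concat)
      (auto simp: lsum_map case_prod_unfold intro!: lsum_cong assms(4)
        dest!: tlistsD[OF assms(2)] tlistsD[OF assms(3)])
qed

text \<open>The second factor enters only through its contractions with the functionals
  \<open>\<lambda>x. l (r x)\<close>, so the class of the product depends only on the class of the
  second factor.\<close>

lemma contract_tmult:
  assumes "l \<in> dual R" "p \<in> tlists R T" "p' \<in> tlists R T"
  shows "contract T l (tmult R T p p') =
    lsum T (\<lambda>(r, a). a \<otimes>\<^bsub>T\<^esub> contract T (\<lambda>x. l (r \<otimes>\<^bsub>R\<^esub> x)) p') p"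
proof -
  have "contract T l (tmult R T p p') =
    lsum T (\<lambda>(r, a). lsum T (\<lambda>(s, b). emb T (l (r \<otimes>\<^bsub>R\<^esub> s)) \<otimes>\<^bsub>T\<^esub> (a \<otimes>\<^bsub>T\<^esub> b)) p') p"
    unfolding contract_def using assms
    by (subst lsum_tmult) (auto simp: T.is_cring)
  also have "\<dots> = lsum T (\<lambda>(r, a). a \<otimes>\<^bsub>T\<^esub> contract T (\<lambda>x. l (r \<otimes>\<^bsub>R\<^esub> x)) p') p"
  proof (rule lsum_cong, clarify)
    fix r a assume ra: "(r, a) \<in> set p"
    then have a: "a \<in> carrier T" using tlistsD[OF assms(2) ra] by auto
    show "lsum T (\<lambda>(s, b). emb T (l (r \<otimes>\<^bsub>R\<^esub> s)) \<otimes>\<^bsub>T\<^esub> (a \<otimes>\<^bsub>T\<^esub> b)) p' =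
      a \<otimes>\<^bsub>T\<^esub> contract T (\<lambda>x. l (r \<otimes>\<^bsub>R\<^esub> x)) p'"
      unfolding contract_def using a
      by (subst T.lsum_ldistr)
        (auto dest!: tlistsD[OF assms(3)] simp: T.m_lcomm intro!: lsum_cong)
  qed
  finally show ?thesis .
qed

text \<open>The two product lists run through the same pairs in different orders; exchanging the
  double sum identifies them after contraction. It also transfers compatibility with
  \<open>teq\<close> from the second argument to the first.\<close>

lemma contract_tmult_commute:
  assumes "l \<in> dual R" "p \<in> tlists R T" "p' \<in> tlists R T"
  shows "contract T l (tmult R T p p') = contract T l (tmult R T p' p)"
proof -
  have "contract T l (tmult R T p p') =
    lsum T (\<lambda>x. lsum T (\<lambda>y. emb T (l (fst x \<otimes>\<^bsub>R\<^esub> fst y)) \<otimes>\<^bsub>T\<^esub> (snd x \<otimes>\<^bsub>T\<^esub> snd y)) p') p"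
    unfolding contract_def using assms
    by (subst lsum_tmult) (auto simp: T.is_cring case_prod_unfold)
  also have "\<dots> = lsum T (\<lambda>y. lsum T (\<lambda>x. emb T (l (fst x \<otimes>\<^bsub>R\<^esub> fst y)) \<otimes>\<^bsub>T\<^esub> (snd x \<otimes>\<^bsub>T\<^esub> snd y)) p) p'"
    using tlistsD[OF assms(2)] tlistsD[OF assms(3)] by (intro T.lsum_swap) auto
  also have "\<dots> = lsum T (\<lambda>y. lsum T (\<lambda>x. emb T (l (fst y \<otimes>\<^bsub>R\<^esub> fst x)) \<otimes>\<^bsub>T\<^esub> (snd y \<otimes>\<^bsub>T\<^esub> snd x)) p) p'"
    using tlistsD[OF assms(2)] tlistsD[OF assms(3)]
    by (intro lsum_cong) (simp add: R.m_comm T.m_comm)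
  also have "\<dots> = contract T l (tmult R T p' p)"
    unfolding contract_def using assms
    by (subst lsum_tmult) (auto simp: T.is_cring case_prod_unfold)
  finally show ?thesis .
qed

lemma teq_refl [simp]: "teq R T p p"
  by (simp add: teq_def)

lemma teq_tmult:
  assumes "p \<in> tlists R T" "p' \<in> tlists R T" "s \<in> tlists R T" "s' \<in> tlists R T"
    "teq R T p p'" "teq R T s s'"
  shows "teq R T (tmult R T p s) (tmult R T p' s')"
proof -
  have *: "contract T l (tmult R T p s) = contract T l (tmult R T p s')"
    if "l \<in> dual R" "p \<in> tlists R T" "s \<in> tlists R T" "s' \<in> tlists R T" "teq R T s s'" for l p s s'
    using that tlistsD[OF that(2)]
    by (auto simp: contract_tmult case_prod_unfold teq_def R.dual_mult intro!: lsum_cong)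
  then show ?thesis
    unfolding teq_def[of _ _ "tmult R T p s"] using assms contract_tmult_commute by metis
qed

lemma teq_append:
  "p \<in> tlists R T \<Longrightarrow> p' \<in> tlists R T \<Longrightarrow> s \<in> tlists R T \<Longrightarrow> s' \<in> tlists R T \<Longrightarrow>
    teq R T p p' \<Longrightarrow> teq R T s s' \<Longrightarrow> teq R T (p @ s) (p' @ s')"
  by (simp add: teq_def contract_append)

lemma trep: "p \<in> tlists R T \<Longrightarrow> trep R T p \<in> tlists R T \<and> teq R T p (trep R T p)"
  unfolding trep_def by (rule someI[of _ p]) simp

lemma from_nat_tcls [simp]: "from_nat (tcls R T p) = trep R T p"
  by (simp add: tcls_def)

lemma tcls_eq_iff:
  assumes "p \<in> tlists R T" "p' \<in> tlists R T"
  shows "tcls R T p = tcls R T p' \<longleftrightarrow> teq R T p p'"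
proof
  assume "tcls R T p = tcls R T p'"
  then have "trep R T p = trep R T p'"
    by (simp add: tcls_def)
  then show "teq R T p p'"
    using trep[OF assms(1)] trep[OF assms(2)] by (simp add: teq_def)
next
  assume "teq R T p p'"
  then have "teq R T p s \<longleftrightarrow> teq R T p' s" for s
    by (auto simp: teq_def)
  then show "tcls R T p = tcls R T p'"
    by (simp add: tcls_def trep_def)
qed

lemma tensor_carrier: "carrier (tensor R T) = tcls R T ` tlists R T"
  and tensor_one: "\<one>\<^bsub>tensor R T\<^esub> = tcls R T [(\<one>\<^bsub>R\<^esub>, \<one>\<^bsub>T\<^esub>)]"
  and tensor_zero: "\<zero>\<^bsub>tensor R T\<^esub> = tcls R T []"
  and tensor_emb: "emb (tensor R T) c = tcls R T [(emb R c, \<one>\<^bsub>T\<^esub>)]"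
  by (simp_all add: tensor_def)

lemma tensor_add:
  assumes "p \<in> tlists R T" "p' \<in> tlists R T"
  shows "tcls R T p \<oplus>\<^bsub>tensor R T\<^esub> tcls R T p' = tcls R T (p @ p')"
proof -
  have "teq R T (trep R T p @ trep R T p') (p @ p')"
    using teq_append trep[OF assms(1)] trep[OF assms(2)] assms by (metis teq_def)
  then show ?thesis
    using assms trep by (simp add: tensor_def tcls_eq_iff)
qed

lemma tensor_mult:
  assumes "p \<in> tlists R T" "p' \<in> tlists R T"
  shows "tcls R T p \<otimes>\<^bsub>tensor R T\<^esub> tcls R T p' = tcls R T (tmult R T p p')"
proof -
  have "teq R T (tmult R T (trep R T p) (trep R T p')) (tmult R T p p')"
    using teq_tmult trep[OF assms(1)] trep[OF assms(2)] assms by (metis teq_def)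
  then show ?thesis
    using assms trep by (simp add: tensor_def tcls_eq_iff tmult_closed)
qed

lemma tmult_assoc:
  assumes "p \<in> tlists R T" "p' \<in> tlists R T" "p'' \<in> tlists R T"
  shows "teq R T (tmult R T (tmult R T p p') p'') (tmult R T p (tmult R T p' p''))"
  unfolding teq_def
proof
  fix l assume l: "l \<in> dual R"
  have "contract T l (tmult R T (tmult R T p p') p'') =
    lsum T (\<lambda>x. lsum T (\<lambda>y. snd x \<otimes>\<^bsub>T\<^esub> snd y \<otimes>\<^bsub>T\<^esub> contract T (\<lambda>z. l (fst x \<otimes>\<^bsub>R\<^esub> fst y \<otimes>\<^bsub>R\<^esub> z)) p'') p') p"
    using assms l
    by (subst contract_tmult)
      (auto simp: tmult_closed lsum_tmult T.is_cring case_prod_unfold)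
  also have "\<dots> = lsum T (\<lambda>x. snd x \<otimes>\<^bsub>T\<^esub>
      lsum T (\<lambda>y. snd y \<otimes>\<^bsub>T\<^esub> contract T (\<lambda>z. l (fst x \<otimes>\<^bsub>R\<^esub> (fst y \<otimes>\<^bsub>R\<^esub> z))) p'') p') p"
  proof (rule lsum_cong)
    fix x assume x: "x \<in> set p"
    have xc: "fst x \<in> carrier R" "snd x \<in> carrier T"
      using tlistsD[OF assms(1) x] by auto
    have "contract T (\<lambda>z. l (fst x \<otimes>\<^bsub>R\<^esub> fst y \<otimes>\<^bsub>R\<^esub> z)) p'' = contract T (\<lambda>z. l (fst x \<otimes>\<^bsub>R\<^esub> (fst y \<otimes>\<^bsub>R\<^esub> z))) p''"
      if "y \<in> set p'" for y
      unfolding contract_def using tlistsD[OF assms(2) that] xc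
      by (intro lsum_cong) (auto dest!: tlistsD[OF assms(3)] simp: R.m_assoc)
    then show "lsum T (\<lambda>y. snd x \<otimes>\<^bsub>T\<^esub> snd y \<otimes>\<^bsub>T\<^esub> contract T (\<lambda>z. l (fst x \<otimes>\<^bsub>R\<^esub> fst y \<otimes>\<^bsub>R\<^esub> z)) p'') p' =
      snd x \<otimes>\<^bsub>T\<^esub> lsum T (\<lambda>y. snd y \<otimes>\<^bsub>T\<^esub> contract T (\<lambda>z. l (fst x \<otimes>\<^bsub>R\<^esub> (fst y \<otimes>\<^bsub>R\<^esub> z))) p'') p'"
      using xc tlistsD[OF assms(2)] assms(3)
      by (subst T.lsum_ldistr) (auto intro!: lsum_cong simp: T.m_assoc)
  qed
  also have "\<dots> = contract T l (tmult R T p (tmult R T p' p''))"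
    using assms l tlistsD[OF assms(1)]
    by (subst contract_tmult[of l p])
      (auto simp: tmult_closed contract_tmult R.dual_mult case_prod_unfold intro!: lsum_cong)
  finally show "contract T l (tmult R T (tmult R T p p') p'') = contract T l (tmult R T p (tmult R T p' p''))" .
qed

lemma tmult_one: "p \<in> tlists R T \<Longrightarrow> tmult R T [(\<one>\<^bsub>R\<^esub>, \<one>\<^bsub>T\<^esub>)] p = p"
  by (auto simp: tmult_def intro!: map_idI dest: tlistsD)

lemma tmult_append: "tmult R T (p @ p') p'' = tmult R T p p'' @ tmult R T p' p''"
  by (simp add: tmult_def)

lemma teq_neg:
  assumes "p \<in> tlists R T"
  shows "teq R T (map (\<lambda>(r, a). (r, \<ominus>\<^bsub>T\<^esub> a)) p @ p) []"
proof -
  define p' where "p' = map (\<lambda>(r, a). (r, \<ominus>\<^bsub>T\<^esub> a)) p"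
  have p': "p' \<in> tlists R T"
    using tlistsD[OF assms] by (auto simp: p'_def intro!: tlistsI)
  have "contract T l p' \<oplus>\<^bsub>T\<^esub> contract T l p = \<zero>\<^bsub>T\<^esub>" for l
  proof -
    have "contract T l p' \<oplus>\<^bsub>T\<^esub> contract T l p =
      lsum T (\<lambda>x. emb T (l (fst x)) \<otimes>\<^bsub>T\<^esub> \<ominus>\<^bsub>T\<^esub> snd x \<oplus>\<^bsub>T\<^esub> emb T (l (fst x)) \<otimes>\<^bsub>T\<^esub> snd x) p"
      using tlistsD[OF assms]
      by (subst T.lsum_add) (auto simp: contract_def p'_def lsum_map case_prod_unfold)
    also have "\<dots> = lsum T (\<lambda>_. \<zero>\<^bsub>T\<^esub>) p"
      using tlistsD[OF assms] by (intro lsum_cong) (simp add: T.r_minus T.l_neg)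
    finally show ?thesis by (simp add: T.lsum_zero)
  qed
  then show ?thesis
    using assms p' unfolding teq_def p'_def[symmetric]
    by (simp add: contract_append) (simp add: contract_def)
qed

lemma fq_algebra_tensor: "fq_algebra (tensor R T)"
proof -
  have "cring (tensor R T)"
  proof (rule cringI)
    show "abelian_group (tensor R T)"
    proof (rule abelian_groupI)
      fix x y z assume "x \<in> carrier (tensor R T)" "y \<in> carrier (tensor R T)" "z \<in> carrier (tensor R T)"
      then obtain p p' p'' where *: "x = tcls R T p" "y = tcls R T p'" "z = tcls R T p''"
        "p \<in> tlists R T" "p' \<in> tlists R T" "p'' \<in> tlists R T"
        by (auto simp: tensor_carrier)
      then show "x \<oplus>\<^bsub>tensor R T\<^esub> y \<in> carrier (tensor R T)"
        by (auto simp: tensor_add tensor_carrier)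
      show "x \<oplus>\<^bsub>tensor R T\<^esub> y \<oplus>\<^bsub>tensor R T\<^esub> z = x \<oplus>\<^bsub>tensor R T\<^esub> (y \<oplus>\<^bsub>tensor R T\<^esub> z)"
        using * by (simp add: tensor_add)
      show "x \<oplus>\<^bsub>tensor R T\<^esub> y = y \<oplus>\<^bsub>tensor R T\<^esub> x"
        using * by (simp add: tensor_add tcls_eq_iff teq_def contract_append T.a_comm)
      show "\<zero>\<^bsub>tensor R T\<^esub> \<oplus>\<^bsub>tensor R T\<^esub> x = x"
        using * by (simp add: tensor_add tensor_zero)
      have "map (\<lambda>(r, a). (r, \<ominus>\<^bsub>T\<^esub> a)) p \<in> tlists R T"
        using tlistsD[OF *(4)] by (auto intro!: tlistsI)
      then show "\<exists>y\<in>carrier (tensor R T). y \<oplus>\<^bsub>tensor R T\<^esub> x = \<zero>\<^bsub>tensor R T\<^esub>"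
        using * teq_neg[OF *(4)]
        by (auto simp: tensor_carrier tensor_zero tensor_add tcls_eq_iff)
    qed (auto simp: tensor_carrier tensor_zero)
    show "Group.comm_monoid (tensor R T)"
    proof (rule comm_monoidI)
      fix x y z assume "x \<in> carrier (tensor R T)" "y \<in> carrier (tensor R T)" "z \<in> carrier (tensor R T)"
      then obtain p p' p'' where *: "x = tcls R T p" "y = tcls R T p'" "z = tcls R T p''"
        "p \<in> tlists R T" "p' \<in> tlists R T" "p'' \<in> tlists R T"
        by (auto simp: tensor_carrier)
      then show "x \<otimes>\<^bsub>tensor R T\<^esub> y \<in> carrier (tensor R T)"
        by (auto simp: tensor_mult tensor_carrier tmult_closed)
      show "x \<otimes>\<^bsub>tensor R T\<^esub> y \<otimes>\<^bsub>tensor R T\<^esub> z = x \<otimes>\<^bsub>tensor R T\<^esub> (y \<otimes>\<^bsub>tensor R T\<^esub> z)"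
        using * by (simp add: tensor_mult tmult_closed tcls_eq_iff tmult_assoc)
      show "x \<otimes>\<^bsub>tensor R T\<^esub> y = y \<otimes>\<^bsub>tensor R T\<^esub> x"
        using * by (simp add: tensor_mult tcls_eq_iff teq_def contract_tmult_commute tmult_closed)
      show "\<one>\<^bsub>tensor R T\<^esub> \<otimes>\<^bsub>tensor R T\<^esub> x = x"
        using * by (simp add: tensor_mult tensor_one tmult_one)
    qed (auto simp: tensor_carrier tensor_one)
    fix x y z assume "x \<in> carrier (tensor R T)" "y \<in> carrier (tensor R T)" "z \<in> carrier (tensor R T)"
    then obtain p p' p'' where *: "x = tcls R T p" "y = tcls R T p'" "z = tcls R T p''"
      "p \<in> tlists R T" "p' \<in> tlists R T" "p'' \<in> tlists R T"
      by (auto simp: tensor_carrier)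
    then show "(x \<oplus>\<^bsub>tensor R T\<^esub> y) \<otimes>\<^bsub>tensor R T\<^esub> z =
        x \<otimes>\<^bsub>tensor R T\<^esub> z \<oplus>\<^bsub>tensor R T\<^esub> y \<otimes>\<^bsub>tensor R T\<^esub> z"
      by (simp add: tensor_mult tensor_add tmult_closed tmult_append)
  qed
  moreover have "emb (tensor R T) \<in> ring_hom ring_of_type_algebra (tensor R T)"
    by (rule ring_hom_memI)
      (auto simp: ring_of_type_algebra_def tensor_emb tensor_carrier tensor_one tensor_mult
        tensor_add tcls_eq_iff teq_def contract_def dual_add R.emb_add T.emb_add T.l_distr
        R.emb_mult tmult_def)
  ultimately show ?thesis
    by (simp add: fq_algebra_def fq_algebra_axioms_def)
qed

interpretation D: fq_algebra "tensor R T" by (rule fq_algebra_tensor)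

lemma in1_alg_hom: "in1 R T \<in> alg_hom R (tensor R T)"
  by (rule alg_homI[OF R fq_algebra_tensor])
    (auto simp: in1_def tensor_emb tensor_carrier tensor_mult tensor_add tcls_eq_iff tmult_def
      teq_def contract_def dual_add T.emb_add)

lemma in2_alg_hom: "in2 R T \<in> alg_hom T (tensor R T)"
proof (rule alg_homI[OF T fq_algebra_tensor])
  fix c
  \<comment> \<open>The structure map of the tensor product was placed in the first factor;
    linearity of the functionals moves the scalar across to the second.\<close>
  have l: "l (emb R c) = c * l \<one>\<^bsub>R\<^esub>" if "l \<in> dual R" for l
    using dual_emb[OF that, of "\<one>\<^bsub>R\<^esub>" c] by simp
  then show "in2 R T (emb T c) = emb (tensor R T) c"
    by (auto simp: in2_def tensor_emb tcls_eq_iff teq_def contract_def l T.emb_mult T.m_comm)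
qed (auto simp: in2_def tensor_carrier tensor_mult tensor_add tcls_eq_iff tmult_def
      teq_def contract_def T.r_distr)

lemma in1_mult_in2: "r \<in> carrier R \<Longrightarrow> a \<in> carrier T \<Longrightarrow> in1 R T r \<otimes>\<^bsub>tensor R T\<^esub> in2 R T a = tcls R T [(r, a)]"
  by (simp add: in1_def in2_def tensor_mult tmult_def)

text \<open>Every tensor is a sum of pure tensors inside the algebra itself, so a homomorphism out
  of it is known from its effect on the two factors.\<close>

lemma tcls_eq_lsum:
  "p \<in> tlists R T \<Longrightarrow> tcls R T p = lsum (tensor R T) (\<lambda>(r, a). in1 R T r \<otimes>\<^bsub>tensor R T\<^esub> in2 R T a) p"
proof (induction p)
  case (Cons x p)
  have "tcls R T (x # p) = tcls R T [x] \<oplus>\<^bsub>tensor R T\<^esub> tcls R T p"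
    using tensor_add[of "[x]" p] Cons.prems by simp
  moreover have "tcls R T [x] = in1 R T (fst x) \<otimes>\<^bsub>tensor R T\<^esub> in2 R T (snd x)"
    using Cons.prems by (simp add: in1_mult_in2)
  moreover have "tcls R T p = lsum (tensor R T) (\<lambda>(r, a). in1 R T r \<otimes>\<^bsub>tensor R T\<^esub> in2 R T a) p"
    using Cons by simp
  ultimately show ?case
    by (simp only: lsum_Cons case_prod_unfold)
qed (simp add: tensor_zero)

text \<open>A functional with value 1 at \<open>\<one>\<close> contracts the unit tensor to
  \<open>\<one>\<close> and the empty list to \<open>\<zero>\<close>.\<close>

lemma tensor_one_neq_zero:
  assumes "\<one>\<^bsub>R\<^esub> \<noteq> \<zero>\<^bsub>R\<^esub>" "\<one>\<^bsub>T\<^esub> \<noteq> \<zero>\<^bsub>T\<^esub>"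
  shows "\<one>\<^bsub>tensor R T\<^esub> \<noteq> \<zero>\<^bsub>tensor R T\<^esub>"
proof
  assume "\<one>\<^bsub>tensor R T\<^esub> = \<zero>\<^bsub>tensor R T\<^esub>"
  then have eq: "contract T l [(\<one>\<^bsub>R\<^esub>, \<one>\<^bsub>T\<^esub>)] = contract T l []" if "l \<in> dual R" for l
    using that by (simp add: tensor_one tensor_zero tcls_eq_iff teq_def)
  obtain l where l: "l \<in> dual R" "l \<one>\<^bsub>R\<^esub> = 1"
    using R.ex_dual_separating[OF R.subspace_zero, of "\<one>\<^bsub>R\<^esub>"] assms(1) by auto
  then show False
    using eq[OF l(1)] assms(2) by (simp add: contract_def)
qed

lemma fg_algebra_tensor:
  assumes "fg_algebra R" "fg_algebra T"
  shows "fg_algebra (tensor R T)"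
proof -
  obtain E where E: "finite E" "E \<subseteq> carrier R" "generate_ring R (range (emb R) \<union> E) = carrier R"
    using assms(1) by (auto simp: fg_algebra_def)
  obtain E' where E': "finite E'" "E' \<subseteq> carrier T" "generate_ring T (range (emb T) \<union> E') = carrier T"
    using assms(2) by (auto simp: fg_algebra_def)
  define G where "G = range (emb (tensor R T)) \<union> (in1 R T ` E \<union> in2 R T ` E')"
  have sub: "in1 R T ` E \<union> in2 R T ` E' \<subseteq> carrier (tensor R T)"
    using E(2) E'(2) alg_hom_closed[OF R fq_algebra_tensor in1_alg_hom]
      alg_hom_closed[OF T fq_algebra_tensor in2_alg_hom] by auto
  have in1: "in1 R T r \<in> generate_ring (tensor R T) G" if "r \<in> carrier R" for r
    by (rule alg_hom_generate_ring[OF R fq_algebra_tensor in1_alg_hom, of "range (emb R) \<union> E"])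
      (use E that in \<open>auto simp: G_def alg_hom_emb[OF R fq_algebra_tensor in1_alg_hom]\<close>)
  have in2: "in2 R T a \<in> generate_ring (tensor R T) G" if "a \<in> carrier T" for a
    by (rule alg_hom_generate_ring[OF T fq_algebra_tensor in2_alg_hom, of "range (emb T) \<union> E'"])
      (use E' that in \<open>auto simp: G_def alg_hom_emb[OF T fq_algebra_tensor in2_alg_hom]\<close>)
  have "lsum (tensor R T) (\<lambda>(r, a). in1 R T r \<otimes>\<^bsub>tensor R T\<^esub> in2 R T a) p \<in> generate_ring (tensor R T) G"
    if "p \<in> tlists R T" for p
    using that
    by (induction p)
      (auto simp: D.zero_in_generate in1 in2 intro!: generate_ring.eng_add generate_ring.eng_mult)
  then have "carrier (tensor R T) \<subseteq> generate_ring (tensor R T) G"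
    by (auto simp: tensor_carrier tcls_eq_lsum)
  moreover have "generate_ring (tensor R T) G \<subseteq> carrier (tensor R T)"
    using sub by (intro D.generate_ring_incl) (auto simp: G_def)
  ultimately show ?thesis
    unfolding fg_algebra_def using E(1) E'(1) sub D.is_cring D.emb_hom
    by (auto simp: G_def intro!: exI[of _ "in1 R T ` E \<union> in2 R T ` E'"])
qed

text \<open>Lists are identified by functionals and not by bilinear relations, so it has to be
  proved that \<open>f\<close> and \<open>g\<close> induce a map on classes. Expanding the first
  components in a finite dual system rewrites the sum so that the list occurs only in its
  contractions.\<close>

lemma lsum_eq_if_teq:
  assumes "fq_algebra U" "f \<in> alg_hom R U" "g \<in> alg_hom T U"
    and "p \<in> tlists R T" "p' \<in> tlists R T" "teq R T p p'"
  shows "lsum U (\<lambda>(r, a). f r \<otimes>\<^bsub>U\<^esub> g a) p = lsum U (\<lambda>(r, a). f r \<otimes>\<^bsub>U\<^esub> g a) p'"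
proof -
  interpret U: fq_algebra U by fact
  note f = alg_hom_closed[OF R assms(1,2)] alg_hom_mult[OF R assms(1,2)] alg_hom_emb[OF R assms(1,2)]
  note g = alg_hom_closed[OF T assms(1,3)] alg_hom_mult[OF T assms(1,3)] alg_hom_emb[OF T assms(1,3)]
  \<comment> \<open>One system must serve both lists, so it is taken for all first components of
    \<open>p\<close> and \<open>p'\<close> together.\<close>
  obtain bs where bs: "set bs \<subseteq> dual R \<times> carrier R"
    "\<And>x. x \<in> fst ` (set p \<union> set p') \<Longrightarrow> x = lsum R (\<lambda>(l, b). emb R (l x) \<otimes>\<^bsub>R\<^esub> b) bs"
  proof -
    have "fst ` (set p \<union> set p') \<subseteq> carrier R"
      using tlistsD[OF assms(4)] tlistsD[OF assms(5)] by blast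
    from R.finite_dual_expansion[OF _ this] show ?thesis
      using that by auto
  qed
  have bsc: "fst y \<in> dual R" "snd y \<in> carrier R" if "y \<in> set bs" for y
    using bs(1) that by auto
  have *: "lsum U (\<lambda>(r, a). f r \<otimes>\<^bsub>U\<^esub> g a) s =
      lsum U (\<lambda>y. f (snd y) \<otimes>\<^bsub>U\<^esub> g (contract T (fst y) s)) bs"
    if s: "s \<in> tlists R T" "set s \<subseteq> set p \<union> set p'" for s
  proof -
    note sc = tlistsD[OF s(1)]
    have "lsum U (\<lambda>(r, a). f r \<otimes>\<^bsub>U\<^esub> g a) s =
      lsum U (\<lambda>x. lsum U (\<lambda>y. emb U (fst y (fst x)) \<otimes>\<^bsub>U\<^esub> f (snd y) \<otimes>\<^bsub>U\<^esub> g (snd x)) bs) s"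
    proof (rule lsum_cong)
      fix x assume x: "x \<in> set s"
      have "f (fst x) = f (lsum R (\<lambda>y. emb R (fst y (fst x)) \<otimes>\<^bsub>R\<^esub> snd y) bs)"
        using bs(2)[of "fst x"] x s(2) by (auto simp: case_prod_unfold)
      also have "\<dots> = lsum U (\<lambda>y. emb U (fst y (fst x)) \<otimes>\<^bsub>U\<^esub> f (snd y)) bs"
        using bsc by (subst alg_hom_lsum[OF R assms(1,2)]) (auto simp: f intro!: lsum_cong)
      finally show "(case x of (r, a) \<Rightarrow> f r \<otimes>\<^bsub>U\<^esub> g a) =
        lsum U (\<lambda>y. emb U (fst y (fst x)) \<otimes>\<^bsub>U\<^esub> f (snd y) \<otimes>\<^bsub>U\<^esub> g (snd x)) bs"
        using bsc sc[OF x] by (simp add: case_prod_unfold U.lsum_rdistr f g)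
    qed
    also have "\<dots> = lsum U (\<lambda>y. lsum U (\<lambda>x. emb U (fst y (fst x)) \<otimes>\<^bsub>U\<^esub> f (snd y) \<otimes>\<^bsub>U\<^esub> g (snd x)) s) bs"
      using bsc sc by (intro U.lsum_swap) (auto simp: f g)
    also have "\<dots> = lsum U (\<lambda>y. f (snd y) \<otimes>\<^bsub>U\<^esub> g (contract T (fst y) s)) bs"
    proof (rule lsum_cong)
      fix y assume y: "y \<in> set bs"
      have "g (contract T (fst y) s) = lsum U (\<lambda>x. emb U (fst y (fst x)) \<otimes>\<^bsub>U\<^esub> g (snd x)) s"
        unfolding contract_def case_prod_unfold
        using sc by (subst alg_hom_lsum[OF T assms(1,3)]) (auto simp: g intro!: lsum_cong)
      then show "lsum U (\<lambda>x. emb U (fst y (fst x)) \<otimes>\<^bsub>U\<^esub> f (snd y) \<otimes>\<^bsub>U\<^esub> g (snd x)) s =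
        f (snd y) \<otimes>\<^bsub>U\<^esub> g (contract T (fst y) s)"
        using sc bsc[OF y] by (simp add: U.lsum_ldistr f g)
          (auto intro!: lsum_cong simp: f g U.m_assoc U.m_lcomm)
    qed
    finally show ?thesis .
  qed
  show ?thesis
    using *[of p] *[of p'] assms(4-6) bsc
    by (auto simp: teq_def intro!: lsum_cong)
qed

lemma tensor_universal:
  assumes "fq_algebra U" "f \<in> alg_hom R U" "g \<in> alg_hom T U"
  obtains h where "h \<in> alg_hom (tensor R T) U"
    "compose (carrier R) h (in1 R T) = f" "compose (carrier T) h (in2 R T) = g"
proof -
  interpret U: fq_algebra U by fact
  note f = alg_hom_closed[OF R assms(1,2)] alg_hom_mult[OF R assms(1,2)] alg_hom_emb[OF R assms(1,2)]
    alg_hom_one[OF R assms(1,2)]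
  note g = alg_hom_closed[OF T assms(1,3)] alg_hom_mult[OF T assms(1,3)] alg_hom_emb[OF T assms(1,3)]
    alg_hom_one[OF T assms(1,3)]
  \<comment> \<open>\<open>from_nat x\<close> is the chosen list of the class \<open>x\<close>; by
    \<open>lsum_eq_if_teq\<close> every other list of the class gives the same value.\<close>
  define h where "h = (\<lambda>x\<in>carrier (tensor R T). lsum U (\<lambda>(r, a). f r \<otimes>\<^bsub>U\<^esub> g a) (from_nat x))"
  have h: "h (tcls R T p) = lsum U (\<lambda>(r, a). f r \<otimes>\<^bsub>U\<^esub> g a) p" if "p \<in> tlists R T" for p
    using lsum_eq_if_teq[OF assms that, of "trep R T p"] trep[OF that] that
    by (simp add: h_def tensor_carrier)
  have fgc: "(case x of (r, a) \<Rightarrow> f r \<otimes>\<^bsub>U\<^esub> g a) \<in> carrier U" if "p \<in> tlists R T" "x \<in> set p" for x p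
    using tlistsD[OF that] f g by (auto simp: case_prod_unfold)
  have "h \<in> alg_hom (tensor R T) U"
  proof (rule alg_homI[OF fq_algebra_tensor assms(1)])
    fix x y assume "x \<in> carrier (tensor R T)" "y \<in> carrier (tensor R T)"
    then obtain p p' where *: "x = tcls R T p" "y = tcls R T p'" "p \<in> tlists R T" "p' \<in> tlists R T"
      by (auto simp: tensor_carrier)
    show "h x \<in> carrier U"
      unfolding * h[OF *(3)] by (intro U.lsum_closed fgc[OF *(3)])
    show "h (x \<oplus>\<^bsub>tensor R T\<^esub> y) = h x \<oplus>\<^bsub>U\<^esub> h y"
      unfolding *(1,2) tensor_add[OF *(3,4)] h[OF *(3)] h[OF *(4)] using *(3,4)
      by (subst h; (intro U.lsum_append)?) (use fgc[OF *(3)] fgc[OF *(4)] in auto)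
    have "lsum U (\<lambda>(r, a). f r \<otimes>\<^bsub>U\<^esub> g a) (tmult R T p p') =
      lsum U (\<lambda>x. lsum U (\<lambda>y. f (fst x \<otimes>\<^bsub>R\<^esub> fst y) \<otimes>\<^bsub>U\<^esub> g (snd x \<otimes>\<^bsub>T\<^esub> snd y)) p') p"
      using *(3,4) by (subst lsum_tmult) (auto simp: U.is_cring case_prod_unfold f(1) g(1))
    also have "\<dots> = lsum U (\<lambda>x. lsum U (\<lambda>y. f (fst x) \<otimes>\<^bsub>U\<^esub> g (snd x) \<otimes>\<^bsub>U\<^esub> (f (fst y) \<otimes>\<^bsub>U\<^esub> g (snd y))) p') p"
      by (intro lsum_cong) (auto dest!: tlistsD[OF *(3)] tlistsD[OF *(4)] simp: f g U.m_ac)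
    also have "\<dots> = lsum U (\<lambda>x. f (fst x) \<otimes>\<^bsub>U\<^esub> g (snd x) \<otimes>\<^bsub>U\<^esub> lsum U (\<lambda>(r, a). f r \<otimes>\<^bsub>U\<^esub> g a) p') p"
      using tlistsD[OF *(3)] tlistsD[OF *(4)]
      by (intro lsum_cong) (auto simp: U.lsum_ldistr f(1) g(1) case_prod_unfold)
    also have "\<dots> = lsum U (\<lambda>(r, a). f r \<otimes>\<^bsub>U\<^esub> g a) p \<otimes>\<^bsub>U\<^esub> lsum U (\<lambda>(r, a). f r \<otimes>\<^bsub>U\<^esub> g a) p'"
      using tlistsD[OF *(3)] tlistsD[OF *(4)]
      by (subst U.lsum_rdistr) (auto simp: f(1) g(1) case_prod_unfold)
    finally show "h (x \<otimes>\<^bsub>tensor R T\<^esub> y) = h x \<otimes>\<^bsub>U\<^esub> h y"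
      using * by (simp add: tensor_mult h tmult_closed)
  next
    show "h (emb (tensor R T) c) = emb U c" for c
      by (simp add: tensor_emb h f g)
  qed (simp add: h_def)
  moreover have "compose (carrier R) h (in1 R T) x = f x" for x
    using assms(2) by (auto simp: compose_def in1_def h f g alg_hom_def extensional_def)
  moreover have "compose (carrier T) h (in2 R T) x = g x" for x
    using assms(3) by (auto simp: compose_def in2_def h f g alg_hom_def extensional_def)
  ultimately show ?thesis
    using that by blast
qed

end

section \<open>Descent\<close>

context comm_monoid
begin

lemma inv_mult_Units: "x \<in> Units G \<Longrightarrow> y \<in> Units G \<Longrightarrow> inv (x \<otimes> y) = inv x \<otimes> inv y"
proof -
  assume xy: "x \<in> Units G" "y \<in> Units G"
  then have c: "x \<in> carrier G" "y \<in> carrier G" "inv x \<in> carrier G" "inv y \<in> carrier G"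
    by auto
  have "(x \<otimes> y) \<otimes> (inv x \<otimes> inv y) = (x \<otimes> inv x) \<otimes> (y \<otimes> inv y)"
    using c by (simp add: m_ac)
  then show ?thesis
    using xy c by (intro comm_inv_char) auto
qed

lemma Units_ratio_mult:
  assumes "x \<in> Units G" "y \<in> Units G" "x' \<in> Units G" "y' \<in> Units G"
  shows "(x \<otimes> inv y) \<otimes> (x' \<otimes> inv y') = (x \<otimes> x') \<otimes> inv (y \<otimes> y')"
proof -
  have c: "x \<in> carrier G" "y \<in> carrier G" "inv x \<in> carrier G" "inv y \<in> carrier G"
    "x' \<in> carrier G" "y' \<in> carrier G" "inv x' \<in> carrier G" "inv y' \<in> carrier G"
    using assms by auto
  show ?thesis
    unfolding inv_mult_Units[OF assms(2,4)] using c by (simp add: m_ac)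
qed

text \<open>Exchanges the middle terms of a proportion. It turns equality of two coboundaries into
  the statement that a ratio of units has equal pullbacks.\<close>

lemma Units_ratio_eq_iff:
  assumes "x \<in> Units G" "y \<in> Units G" "x' \<in> Units G" "y' \<in> Units G"
  shows "x \<otimes> inv y = x' \<otimes> inv y' \<longleftrightarrow> x \<otimes> inv x' = y \<otimes> inv y'"
proof -
  have c: "x \<in> carrier G" "y \<in> carrier G" "inv x \<in> carrier G" "inv y \<in> carrier G"
    "x' \<in> carrier G" "y' \<in> carrier G" "inv x' \<in> carrier G" "inv y' \<in> carrier G"
    using assms by auto
  \<comment> \<open>One direction is enough: exchanging \<open>y\<close> and \<open>x'\<close> turns
    it into the other.\<close>
  have *: "x \<otimes> inv x' = y \<otimes> inv y'"
    if "x \<otimes> inv y = x' \<otimes> inv y'" "x \<in> Units G" "y \<in> Units G" "x' \<in> Units G" "y' \<in> Units G" for x y x' y'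
  proof -
    have c: "x \<in> carrier G" "y \<in> carrier G" "inv x \<in> carrier G" "inv y \<in> carrier G"
      "x' \<in> carrier G" "y' \<in> carrier G" "inv x' \<in> carrier G" "inv y' \<in> carrier G"
      using that by auto
    have "x \<otimes> inv x' = (x \<otimes> inv x') \<otimes> (y \<otimes> inv y)"
      using that c by simp
    also have "\<dots> = (x \<otimes> inv y) \<otimes> (inv x' \<otimes> y)"
      using c by (simp add: m_ac)
    also have "\<dots> = (x' \<otimes> inv x') \<otimes> (y \<otimes> inv y')"
      unfolding that(1) using c by (simp add: m_ac)
    finally show ?thesis
      using that c by simp
  qed
  show ?thesis
    using *[of x y x' y'] *[of x x' y y'] assms by blast
qed

lemma inv_power_Units: "x \<in> Units G \<Longrightarrow> inv (x [^] (n::nat)) = inv x [^] n"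
proof (induction n)
  case (Suc n)
  have "x [^] n \<in> Units G"
    using Suc.prems by (induction n) auto
  then show ?case
    using Suc by (simp add: inv_mult_Units)
qed simp

lemma Units_power [intro]: "x \<in> Units G \<Longrightarrow> x [^] (n::nat) \<in> Units G"
  by (induction n) auto

text \<open>The inverse is the power with exponent \<open>n - 1\<close> divided by the n-th power.
  It applies to roots of unity and to roots of nonzero scalars alike.\<close>

lemma Units_if_power_Units:
  assumes "x \<in> carrier G" "x [^] (n::nat) \<in> Units G" "n > 0"
  shows "x \<in> Units G"
proof -
  obtain m where n: "n = Suc m" using assms(3) by (cases n) auto
  define y where "y = x [^] m \<otimes> inv (x [^] n)"
  have y: "y \<in> carrier G" using assms by (simp add: y_def)
  have "x \<otimes> y = x [^] n \<otimes> inv (x [^] n)"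
    using assms(1,2) m_assoc[of x "x [^] m" "inv (x [^] n)"] m_comm[of x "x [^] m"]
    by (simp add: n y_def)
  then have "x \<otimes> y = \<one>"
    using assms(2) by simp
  then show ?thesis
    using assms(1) y m_comm[OF y assms(1)] unfolding Units_def by auto
qed

end

section \<open>Descent of elements along a covering\<close>

lemma alg_hom_inv:
  assumes "fq_algebra R" "fq_algebra T" "f \<in> alg_hom R T" "x \<in> Units R"
  shows "f (inv\<^bsub>R\<^esub> x) = inv\<^bsub>T\<^esub> f x"
proof -
  interpret R: fq_algebra R by fact
  interpret T: fq_algebra T by fact
  have "f x \<otimes>\<^bsub>T\<^esub> f (inv\<^bsub>R\<^esub> x) = \<one>\<^bsub>T\<^esub>"
    using alg_hom_mult[OF assms(1-3), of x "inv\<^bsub>R\<^esub> x"] alg_hom_one[OF assms(1-3)] assms(4)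
    by auto
  then show ?thesis
    using T.comm_inv_char alg_hom_closed[OF assms(1-3)] assms(4) by (metis R.Units_closed R.Units_inv_closed)
qed

lemma alg_hom_id:
  assumes "fq_algebra R"
  shows "(\<lambda>x\<in>carrier R. x) \<in> alg_hom R R"
proof -
  interpret R: fq_algebra R by fact
  show ?thesis by (rule alg_homI[OF assms assms]) auto
qed

text \<open>Contract \<open>x \<otimes> 1 = 1 \<otimes> x\<close> in the first factor with a
  functional that is 1 at \<open>\<one>\<close>: the left side becomes the scalar \<open>l x\<close>
  and the right side becomes \<open>x\<close>.\<close>

lemma equalizer_of_coprojections:
  assumes "fq_algebra R" "\<one>\<^bsub>R\<^esub> \<noteq> \<zero>\<^bsub>R\<^esub>" "x \<in> carrier R" "in1 R R x = in2 R R x"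
  shows "x \<in> range (emb R)"
proof -
  interpret R: fq_algebra R by fact
  have "teq R R [(x, \<one>\<^bsub>R\<^esub>)] [(\<one>\<^bsub>R\<^esub>, x)]"
    using assms(3,4) by (simp add: in1_def in2_def tcls_eq_iff[OF assms(1,1)] tlists_Cons[OF assms(1,1)] tlists_Nil[OF assms(1,1)])
  moreover obtain l where l: "l \<in> dual R" "l \<one>\<^bsub>R\<^esub> = 1"
    using R.ex_dual_separating[OF R.subspace_zero, of "\<one>\<^bsub>R\<^esub>"] assms(2) by auto
  ultimately have "contract R l [(x, \<one>\<^bsub>R\<^esub>)] = contract R l [(\<one>\<^bsub>R\<^esub>, x)]"
    by (simp add: teq_def)
  then have "x = emb R (l x)"
    using l assms(3) by (simp add: contract_def)
  then show ?thesis by blast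
qed

lemma fppf_coverD:
  assumes "fppf_cover R"
  shows "fq_algebra R" "fg_algebra R" "\<one>\<^bsub>R\<^esub> \<noteq> \<zero>\<^bsub>R\<^esub>"
  using assms by (auto simp: fppf_cover_def fg_algebra_imp_fq_algebra)

lemma fppf_cover_tensor: "fppf_cover R \<Longrightarrow> fppf_cover S \<Longrightarrow> fppf_cover (tensor R S)"
  by (simp add: fppf_cover_def fg_algebra_tensor tensor_one_neq_zero fg_algebra_imp_fq_algebra)

lemma descent_of_elements:
  assumes "fppf_cover R" "x \<in> carrier R"
    and "\<And>T f g. fg_algebra T \<Longrightarrow> f \<in> alg_hom R T \<Longrightarrow> g \<in> alg_hom R T \<Longrightarrow> f x = g x"
  shows "x \<in> range (emb R)"
  using assms fppf_coverD[OF assms(1)]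
  by (intro equalizer_of_coprojections)
    (auto intro!: fg_algebra_tensor in1_alg_hom in2_alg_hom)

section \<open>Hilbert 90 for cocycles of roots of unity\<close>

context
  fixes k :: nat and R :: "'a::{field,finite} falg" and \<zeta> :: "'a cochain"
  assumes cocycle: "(R, \<zeta>) \<in> cocycles k" and k: "k > 0"
begin

lemma cocycle_cover: "fppf_cover R"
  and cocycle_mu: "fg_algebra T \<Longrightarrow> f \<in> alg_hom R T \<Longrightarrow> g \<in> alg_hom R T \<Longrightarrow> \<zeta> T f g \<in> mu k T"
  and cocycle_natural: "fg_algebra T \<Longrightarrow> fg_algebra T' \<Longrightarrow> h \<in> alg_hom T T' \<Longrightarrow> f \<in> alg_hom R T \<Longrightarrow>
    g \<in> alg_hom R T \<Longrightarrow> h (\<zeta> T f g) = \<zeta> T' (compose (carrier R) h f) (compose (carrier R) h g)"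
  and cocycle_mult: "fg_algebra T \<Longrightarrow> f \<in> alg_hom R T \<Longrightarrow> g \<in> alg_hom R T \<Longrightarrow> h \<in> alg_hom R T \<Longrightarrow>
    \<zeta> T f g \<otimes>\<^bsub>T\<^esub> \<zeta> T g h = \<zeta> T f h"
  using cocycle unfolding cocycles_def by blast+

lemma cocycle_closed: "fg_algebra T \<Longrightarrow> f \<in> alg_hom R T \<Longrightarrow> g \<in> alg_hom R T \<Longrightarrow> \<zeta> T f g \<in> carrier T"
  using cocycle_mu by (auto simp: mu_def)

text \<open>Yoneda: the value at the two coprojections is a sum of pure tensors, and naturality
  along the map \<open>R \<otimes> R \<rightarrow> T\<close> induced by \<open>f\<close> and
  \<open>g\<close> transports this one expansion to every pair of points.\<close>

lemma ex_cocycle_expansion: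
  obtains p where "p \<in> tlists R R"
    "\<And>T f g. fg_algebra T \<Longrightarrow> f \<in> alg_hom R T \<Longrightarrow> g \<in> alg_hom R T \<Longrightarrow>
      \<zeta> T f g = lsum T (\<lambda>(r, a). f r \<otimes>\<^bsub>T\<^esub> g a) p"
proof -
  note R = fppf_coverD[OF cocycle_cover]
  note D = fq_algebra_tensor[OF R(1,1)] fg_algebra_tensor[OF R(1,1,2,2)]
  note i = in1_alg_hom[OF R(1,1)] in2_alg_hom[OF R(1,1)]
  interpret R: fq_algebra R by (rule R)
  interpret D: fq_algebra "tensor R R" by (rule D)
  have "\<zeta> (tensor R R) (in1 R R) (in2 R R) \<in> carrier (tensor R R)"
    by (rule cocycle_closed[OF D(2) i])
  then obtain p where p: "p \<in> tlists R R" "\<zeta> (tensor R R) (in1 R R) (in2 R R) = tcls R R p"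
    by (auto simp: tensor_carrier[OF R(1,1)])
  show ?thesis
  proof
    show "p \<in> tlists R R" by fact
    fix T :: "'a falg" and f g
    assume T: "fg_algebra T" and fg: "f \<in> alg_hom R T" "g \<in> alg_hom R T"
    note T' = fg_algebra_imp_fq_algebra[OF T]
    obtain h where h: "h \<in> alg_hom (tensor R R) T"
      "compose (carrier R) h (in1 R R) = f" "compose (carrier R) h (in2 R R) = g"
      using tensor_universal[OF R(1,1) T' fg] by blast
    have "\<zeta> T f g = h (tcls R R p)"
      using cocycle_natural[OF D(2) T h(1) i] h p by simp
    also have "\<dots> = lsum T (\<lambda>x. h (case x of (r, a) \<Rightarrow> in1 R R r \<otimes>\<^bsub>tensor R R\<^esub> in2 R R a)) p"
      unfolding tcls_eq_lsum[OF R(1,1) p(1)]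
      by (rule alg_hom_lsum[OF D(1) T' h(1)])
        (use tlistsD[OF R(1,1) p(1)] alg_hom_closed[OF R(1) D(1) i(1)] alg_hom_closed[OF R(1) D(1) i(2)]
          in auto)
    also have "\<dots> = lsum T (\<lambda>(r, a). f r \<otimes>\<^bsub>T\<^esub> g a) p"
    proof (rule lsum_cong)
      fix x assume x: "x \<in> set p"
      have c: "fst x \<in> carrier R" "snd x \<in> carrier R"
        using tlistsD[OF R(1,1) p(1) x] by auto
      have "h (in1 R R (fst x) \<otimes>\<^bsub>tensor R R\<^esub> in2 R R (snd x)) =
          h (in1 R R (fst x)) \<otimes>\<^bsub>T\<^esub> h (in2 R R (snd x))"
        using alg_hom_mult[OF D(1) T' h(1)] alg_hom_closed[OF R(1) D(1) i(1)]
          alg_hom_closed[OF R(1) D(1) i(2)] c by simp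
      moreover have "h (in1 R R (fst x)) = f (fst x)" "h (in2 R R (snd x)) = g (snd x)"
        using c h(2,3) by (auto simp: compose_def fun_eq_iff split: if_splits)
      ultimately show "h (case x of (r, a) \<Rightarrow> in1 R R r \<otimes>\<^bsub>tensor R R\<^esub> in2 R R a) =
          (case x of (r, a) \<Rightarrow> f r \<otimes>\<^bsub>T\<^esub> g a)"
        by (simp add: case_prod_unfold)
    qed
    finally show "\<zeta> T f g = lsum T (\<lambda>(r, a). f r \<otimes>\<^bsub>T\<^esub> g a) p" .
  qed
qed

text \<open>
  Hilbert 90 by descent: contracting the first factor of the universal cocycle in \<open>R \<otimes> R\<close> with a
  linear functional gives \<open>b \<in> R\<close> with \<open>g b \<cdot> \<zeta>(g, h) = h b\<close>. If \<open>b\<close> is not a unit, some functional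
  kills \<open>b R\<close> but not \<open>1\<close>; applying it to \<open>(b \<otimes> 1) \<cdot> \<zeta> = 1 \<otimes> b\<close> shows \<open>b = 0\<close>.
\<close>

lemma cocycle_eq_cobd:
  obtains b where "b \<in> Units R"
    "\<And>T f g. fg_algebra T \<Longrightarrow> f \<in> alg_hom R T \<Longrightarrow> g \<in> alg_hom R T \<Longrightarrow> \<zeta> T f g = cobd b T f g"
proof -
  note R = fppf_coverD[OF cocycle_cover]
  note D = fq_algebra_tensor[OF R(1,1)] fg_algebra_tensor[OF R(1,1,2,2)]
  note i = in1_alg_hom[OF R(1,1)] in2_alg_hom[OF R(1,1)]
  interpret R: fq_algebra R by (rule R)
  interpret D: fq_algebra "tensor R R" by (rule D)
  obtain p where p: "p \<in> tlists R R"
    and \<zeta>: "\<And>T f g. fg_algebra T \<Longrightarrow> f \<in> alg_hom R T \<Longrightarrow> g \<in> alg_hom R T \<Longrightarrow>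
      \<zeta> T f g = lsum T (\<lambda>(r, a). f r \<otimes>\<^bsub>T\<^esub> g a) p"
    using ex_cocycle_expansion by metis
  note pc = tlistsD[OF R(1,1) p]
  have bc: "contract R l p \<in> carrier R" for l
    using contract_closed[OF R(1,1) p] .
  \<comment> \<open>Work in \<open>R \<otimes> T\<close> with the point \<open>in1\<close> and the
    points \<open>g\<close>, \<open>h\<close> pushed into the second factor. The cocycle identity
    for these three points, contracted in the first factor, is the claim: the value at
    \<open>g\<close>, \<open>h\<close> lives in \<open>T\<close> and comes out of the
    contraction.\<close>
  have contracted: "g (contract R l p) \<otimes>\<^bsub>T\<^esub> \<zeta> T g h = h (contract R l p)"
    if l: "l \<in> dual R" and T: "fg_algebra T" and g: "g \<in> alg_hom R T" and h: "h \<in> alg_hom R T" for l T g h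
  proof -
    note T' = fg_algebra_imp_fq_algebra[OF T]
    interpret T: fq_algebra T by (rule T')
    note E = fq_algebra_tensor[OF R(1) T'] fg_algebra_tensor[OF R(1) T' R(2) T]
    interpret E: fq_algebra "tensor R T" by (rule E)
    note j1 = in1_alg_hom[OF R(1) T'] and j2 = in2_alg_hom[OF R(1) T']
    have zc: "\<zeta> T g h \<in> carrier T" by (rule cocycle_closed[OF T g h])
    define pm where "pm u = map (\<lambda>(r, a). (r, u a)) p" for u :: "nat \<Rightarrow> nat"
    have pm: "pm u \<in> tlists R T" if "u \<in> alg_hom R T" for u
      using pc alg_hom_closed[OF R(1) T' that] by (auto simp: pm_def tlists_def)
    have jh: "compose (carrier R) (in2 R T) u \<in> alg_hom R (tensor R T)" if "u \<in> alg_hom R T" for u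
      by (rule alg_hom_compose[OF R(1) T' E(1) that j2])
    have \<zeta>1: "\<zeta> (tensor R T) (in1 R T) (compose (carrier R) (in2 R T) u) = tcls R T (pm u)"
      if "u \<in> alg_hom R T" for u
      unfolding \<zeta>[OF E(2) j1 jh[OF that]] tcls_eq_lsum[OF R(1) T' pm[OF that]]
      by (auto simp: pm_def lsum_map compose_def intro!: lsum_cong dest!: pc)
    have "tcls R T (pm g) \<otimes>\<^bsub>tensor R T\<^esub> in2 R T (\<zeta> T g h) = tcls R T (pm h)"
      using cocycle_mult[OF E(2) j1 jh[OF g] jh[OF h]] cocycle_natural[OF T E(2) j2 g h]
      by (simp add: \<zeta>1 g h)
    then have "teq R T (tmult R T (pm g) [(\<one>\<^bsub>R\<^esub>, \<zeta> T g h)]) (pm h)"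
      using zc pm[OF g] pm[OF h]
      by (simp add: in2_def tensor_mult[OF R(1) T'] tcls_eq_iff[OF R(1) T'] tmult_closed[OF R(1) T']
          tlists_Cons[OF R(1) T'] tlists_Nil[OF R(1) T'])
    then have "contract T l (tmult R T [(\<one>\<^bsub>R\<^esub>, \<zeta> T g h)] (pm g)) = contract T l (pm h)"
      using contract_tmult_commute[OF R(1) T' l pm[OF g], of "[(\<one>\<^bsub>R\<^esub>, \<zeta> T g h)]"] l zc
      by (simp add: teq_def tlists_Cons[OF R(1) T'] tlists_Nil[OF R(1) T'])
    moreover have "contract T l (pm u) = u (contract R l p)" if "u \<in> alg_hom R T" for u
    proof -
      have "u (contract R l p) = lsum T (\<lambda>x. u (case x of (r, a) \<Rightarrow> emb R (l r) \<otimes>\<^bsub>R\<^esub> a)) p"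
        unfolding contract_def by (rule alg_hom_lsum[OF R(1) T' that]) (auto dest!: pc)
      then show ?thesis
        by (auto simp: contract_def pm_def lsum_map alg_hom_mult[OF R(1) T' that]
            alg_hom_emb[OF R(1) T' that] intro!: lsum_cong dest!: pc)
    qed
    moreover have "tmult R T [(\<one>\<^bsub>R\<^esub>, \<zeta> T g h)] (pm g) = map (\<lambda>(r, a). (r, \<zeta> T g h \<otimes>\<^bsub>T\<^esub> a)) (pm g)"
      by (auto simp: tmult_def dest!: tlistsD[OF R(1) T' pm[OF g]])
    moreover have "contract T l (map (\<lambda>(r, a). (r, \<zeta> T g h \<otimes>\<^bsub>T\<^esub> a)) (pm g)) = \<zeta> T g h \<otimes>\<^bsub>T\<^esub> contract T l (pm g)"
      unfolding contract_def using zc tlistsD[OF R(1) T' pm[OF g]]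
      by (subst T.lsum_ldistr) (auto simp: lsum_map case_prod_unfold T.m_lcomm intro!: lsum_cong)
    ultimately show ?thesis
      using zc g h bc alg_hom_closed[OF R(1) T' g] by (simp add: T.m_comm)
  qed
  \<comment> \<open>If all contractions vanished, the universal value would be the zero tensor, and
    so would be its value at the pair of identities. That value has k-th power one, which is
    impossible for zero as \<open>k > 0\<close>.\<close>
  have "\<exists>l\<in>dual R. contract R l p \<noteq> \<zero>\<^bsub>R\<^esub>"
  proof (rule ccontr)
    assume "\<not> ?thesis"
    then have "teq R R p []"
      by (auto simp: teq_def) (simp add: contract_def)
    note id = alg_hom_id[OF R(1)]
    have "\<zeta> R (\<lambda>x\<in>carrier R. x) (\<lambda>x\<in>carrier R. x) = \<zero>\<^bsub>R\<^esub>"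
      using lsum_eq_if_teq[OF R(1,1,1) id id p _ \<open>teq R R p []\<close>] \<zeta>[OF R(2) id id]
      by (simp add: tlists_Nil[OF R(1,1)])
    then have "\<zero>\<^bsub>R\<^esub> [^]\<^bsub>R\<^esub> k = \<one>\<^bsub>R\<^esub>"
      using cocycle_mu[OF R(2) id id] by (simp add: mu_def)
    then show False
      using k R(3) by (cases k) auto
  qed
  then obtain l where l: "l \<in> dual R" "contract R l p \<noteq> \<zero>\<^bsub>R\<^esub>" by blast
  define b where "b = contract R l p"
  have b: "b \<in> carrier R" "b \<noteq> \<zero>\<^bsub>R\<^esub>" using l bc by (auto simp: b_def)
  have "b \<in> Units R"
  proof (rule ccontr)
    assume nu: "b \<notin> Units R"
    define W where "W = (\<lambda>x. b \<otimes>\<^bsub>R\<^esub> x) ` carrier R"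
    have "subspace_of W R"
      unfolding subspace_of_def
    proof (intro conjI ballI allI)
      show "W \<subseteq> carrier R" "\<zero>\<^bsub>R\<^esub> \<in> W" using b by (auto simp: W_def intro!: image_eqI[of _ _ "\<zero>\<^bsub>R\<^esub>"])
      fix x y assume "x \<in> W" "y \<in> W"
      then obtain x' y' where "x = b \<otimes>\<^bsub>R\<^esub> x'" "y = b \<otimes>\<^bsub>R\<^esub> y'" "x' \<in> carrier R" "y' \<in> carrier R"
        by (auto simp: W_def)
      then show "x \<oplus>\<^bsub>R\<^esub> y \<in> W"
        using b by (auto simp: W_def R.r_distr intro!: image_eqI[of _ _ "x' \<oplus>\<^bsub>R\<^esub> y'"])
    next
      fix c x assume "x \<in> W"
      then obtain x' where "x = b \<otimes>\<^bsub>R\<^esub> x'" "x' \<in> carrier R"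
        by (auto simp: W_def)
      then show "emb R c \<otimes>\<^bsub>R\<^esub> x \<in> W"
        using b by (auto simp: W_def R.m_lcomm intro!: image_eqI[of _ _ "emb R c \<otimes>\<^bsub>R\<^esub> x'"])
    qed
    moreover have "\<one>\<^bsub>R\<^esub> \<notin> W"
    proof
      assume "\<one>\<^bsub>R\<^esub> \<in> W"
      then obtain x where x: "b \<otimes>\<^bsub>R\<^esub> x = \<one>\<^bsub>R\<^esub>" "x \<in> carrier R" by (auto simp: W_def)
      then have "b \<in> Units R"
        using b R.m_comm[of x b] unfolding Units_def by auto
      then show False using nu by simp
    qed
    ultimately obtain m where m: "m \<in> dual R" "\<And>x. x \<in> W \<Longrightarrow> m x = 0" "m \<one>\<^bsub>R\<^esub> = 1"
      using R.ex_dual_separating[of W "\<one>\<^bsub>R\<^esub>"] by auto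
    have L: "[(b, \<one>\<^bsub>R\<^esub>)] \<in> tlists R R" "[(\<one>\<^bsub>R\<^esub>, b)] \<in> tlists R R"
      using b by (auto simp: tlists_def)
    have "\<zeta> (tensor R R) (in1 R R) (in2 R R) = tcls R R p"
      unfolding \<zeta>[OF D(2) i] tcls_eq_lsum[OF R(1,1) p] ..
    then have "tcls R R [(b, \<one>\<^bsub>R\<^esub>)] \<otimes>\<^bsub>tensor R R\<^esub> tcls R R p = tcls R R [(\<one>\<^bsub>R\<^esub>, b)]"
      using contracted[OF l(1) D(2) i] b by (simp add: b_def[symmetric] in1_def in2_def)
    then have "contract R m (tmult R R [(b, \<one>\<^bsub>R\<^esub>)] p) = contract R m [(\<one>\<^bsub>R\<^esub>, b)]"
      using m(1) L p
      by (simp add: tensor_mult[OF R(1,1)] tcls_eq_iff[OF R(1,1)] tmult_closed[OF R(1,1)] teq_def)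
    moreover have "contract R m (tmult R R [(b, \<one>\<^bsub>R\<^esub>)] p) = \<zero>\<^bsub>R\<^esub>"
    proof -
      have "contract R (\<lambda>x. m (b \<otimes>\<^bsub>R\<^esub> x)) p = lsum R (\<lambda>_. \<zero>\<^bsub>R\<^esub>) p"
        unfolding contract_def by (rule lsum_cong) (auto dest!: pc simp: m(2) W_def)
      then show ?thesis
        using contract_tmult[OF R(1,1) m(1) L(1) p] by (simp add: R.lsum_zero)
    qed
    ultimately show False
      using m(3) b by (simp add: contract_def)
  qed
  moreover have "\<zeta> T f g = cobd b T f g"
    if "fg_algebra T" "f \<in> alg_hom R T" "g \<in> alg_hom R T" for T f g
  proof -
    note T' = fg_algebra_imp_fq_algebra[OF that(1)]
    interpret T: fq_algebra T by (rule T')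
    have u: "f b \<in> Units T" "g b \<in> Units T"
      using alg_hom_Units[OF R(1) T'] that \<open>b \<in> Units R\<close> by auto
    have zc: "\<zeta> T f g \<in> carrier T" by (rule cocycle_closed[OF that])
    have "g b = f b \<otimes>\<^bsub>T\<^esub> \<zeta> T f g"
      using contracted[OF l(1) that] by (simp add: b_def)
    then have "g b \<otimes>\<^bsub>T\<^esub> inv\<^bsub>T\<^esub> f b = (f b \<otimes>\<^bsub>T\<^esub> inv\<^bsub>T\<^esub> f b) \<otimes>\<^bsub>T\<^esub> \<zeta> T f g"
      using u zc by (metis T.Units_closed T.Units_inv_closed T.m_assoc T.m_comm)
    then show ?thesis
      using u zc by (simp add: cobd_def)
  qed
  ultimately show ?thesis
    using that by blast
qed

end

section \<open>Kummer theory\<close>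

text \<open>The image of \<open>a\<close> under the connecting map of the Kummer sequence:
  \<open>b\<close> is a k-th root of \<open>a\<close> over the covering. Agreement with the
  coboundary is asked only at points of \<open>R\<close>, so the set is saturated under changing
  irrelevant values of a cochain.\<close>

definition kummer_class :: "nat \<Rightarrow> 'a::{field,finite} \<Rightarrow> ('a falg \<times> 'a cochain) set" where
  "kummer_class k a = {(R, \<zeta>). fppf_cover R \<and> (\<exists>b\<in>Units R. b [^]\<^bsub>R\<^esub> k = emb R a \<and>
     (\<forall>T. fg_algebra T \<longrightarrow> (\<forall>f\<in>alg_hom R T. \<forall>g\<in>alg_hom R T. \<zeta> T f g = cobd b T f g)))}"

lemma kummer_classE:
  assumes "(R, \<zeta>) \<in> kummer_class k a"
  obtains b where "fppf_cover R" "b \<in> Units R" "b [^]\<^bsub>R\<^esub> k = emb R a"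
    "\<And>T f g. fg_algebra T \<Longrightarrow> f \<in> alg_hom R T \<Longrightarrow> g \<in> alg_hom R T \<Longrightarrow> \<zeta> T f g = cobd b T f g"
  using assms unfolding kummer_class_def by auto

lemma kummer_classI:
  assumes "fppf_cover R" "b \<in> Units R" "b [^]\<^bsub>R\<^esub> k = emb R a"
    "\<And>T f g. fg_algebra T \<Longrightarrow> f \<in> alg_hom R T \<Longrightarrow> g \<in> alg_hom R T \<Longrightarrow> \<zeta> T f g = cobd b T f g"
  shows "(R, \<zeta>) \<in> kummer_class k a"
  using assms unfolding kummer_class_def by auto

lemma cobd_closed:
  assumes "fq_algebra R" "fq_algebra T" "f \<in> alg_hom R T" "g \<in> alg_hom R T" "b \<in> Units R"
  shows "cobd b T f g \<in> Units T"
proof -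
  interpret T: fq_algebra T by fact
  show ?thesis
    using alg_hom_Units[OF assms(1,2)] assms(3-5) by (simp add: cobd_def)
qed

lemma cobd_mult:
  assumes "fq_algebra R" "fq_algebra T" "f \<in> alg_hom R T" "g \<in> alg_hom R T" "b \<in> Units R" "b' \<in> Units R"
  shows "cobd (b \<otimes>\<^bsub>R\<^esub> b') T f g = cobd b T f g \<otimes>\<^bsub>T\<^esub> cobd b' T f g"
proof -
  interpret R: fq_algebra R by fact
  interpret T: fq_algebra T by fact
  show ?thesis
    using alg_hom_Units[OF assms(1,2)] assms(3-6)
    by (simp add: cobd_def alg_hom_mult[OF assms(1,2)] R.Units_closed T.Units_ratio_mult)
qed

lemma cobd_emb:
  assumes "fq_algebra R" "fq_algebra T" "f \<in> alg_hom R T" "g \<in> alg_hom R T" "c \<noteq> 0"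
  shows "cobd (emb R c) T f g = \<one>\<^bsub>T\<^esub>"
proof -
  interpret T: fq_algebra T by fact
  show ?thesis
    using T.emb_Units[OF assms(5)]
    by (simp add: cobd_def alg_hom_emb[OF assms(1,2,3)] alg_hom_emb[OF assms(1,2,4)])
qed

lemma cobd_compose:
  "b \<in> carrier R \<Longrightarrow> cobd b T (compose (carrier R) f r) (compose (carrier R) g r) = cobd (r b) T f g"
  by (simp add: cobd_def compose_def)

lemma cobd_power:
  assumes "fq_algebra R" "fq_algebra T" "f \<in> alg_hom R T" "g \<in> alg_hom R T" "b \<in> Units R"
  shows "cobd b T f g [^]\<^bsub>T\<^esub> (k::nat) = cobd (b [^]\<^bsub>R\<^esub> k) T f g"
proof -
  interpret R: fq_algebra R by fact
  interpret T: fq_algebra T by fact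
  show ?thesis
    using alg_hom_Units[OF assms(1,2)] assms(3-5)
    by (simp add: cobd_def alg_hom_power[OF assms(1,2)] R.Units_closed T.nat_pow_distrib
        T.inv_power_Units T.Units_closed)
qed

text \<open>The k-th power of the coboundary of \<open>b\<close> is the coboundary of the scalar
  \<open>a\<close>, hence trivial; the cocycle identity is cancellation of
  \<open>g b\<close>.\<close>

lemma kummer_class_subset_cocycles:
  assumes "(R, \<zeta>) \<in> kummer_class k a" "a \<noteq> 0"
  shows "(R, \<zeta>) \<in> cocycles k"
proof -
  obtain b where b: "fppf_cover R" "b \<in> Units R" "b [^]\<^bsub>R\<^esub> k = emb R a"
    and \<zeta>: "\<And>T f g. fg_algebra T \<Longrightarrow> f \<in> alg_hom R T \<Longrightarrow> g \<in> alg_hom R T \<Longrightarrow> \<zeta> T f g = cobd b T f g"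
    using assms(1) by (rule kummer_classE) blast
  note R = fppf_coverD[OF b(1)]
  interpret R: fq_algebra R by (rule R)
  have "\<zeta> T f g \<in> mu k T" if T: "fg_algebra T" and f: "f \<in> alg_hom R T" and g: "g \<in> alg_hom R T" for T f g
  proof -
    note T' = fg_algebra_imp_fq_algebra[OF T]
    interpret T: fq_algebra T by (rule T')
    show ?thesis
      using cobd_closed[OF R(1) T' f g b(2)] cobd_power[OF R(1) T' f g b(2), of k]
        cobd_emb[OF R(1) T' f g assms(2)] b(3)
      by (simp add: \<zeta>[OF T f g] mu_def T.Units_closed)
  qed
  moreover have "h (\<zeta> T f g) = \<zeta> T' (compose (carrier R) h f) (compose (carrier R) h g)"
    if T: "fg_algebra T" and T': "fg_algebra T'" and h: "h \<in> alg_hom T T'"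
      and f: "f \<in> alg_hom R T" and g: "g \<in> alg_hom R T" for T T' h f g
  proof -
    note TT = fg_algebra_imp_fq_algebra[OF T] fg_algebra_imp_fq_algebra[OF T']
    interpret T: fq_algebra T by (rule TT)
    have u: "f b \<in> Units T" "g b \<in> Units T"
      using alg_hom_Units[OF R(1) TT(1)] f g b(2) by auto
    show ?thesis
      unfolding \<zeta>[OF T f g] \<zeta>[OF T' alg_hom_compose[OF R(1) TT f h] alg_hom_compose[OF R(1) TT g h]]
      using u b(2) alg_hom_mult[OF TT h] alg_hom_inv[OF TT h]
      by (simp add: cobd_def compose_def R.Units_closed T.Units_closed)
  qed
  moreover have "\<zeta> T f g \<otimes>\<^bsub>T\<^esub> \<zeta> T g h = \<zeta> T f h"
    if T: "fg_algebra T" and f: "f \<in> alg_hom R T" and g: "g \<in> alg_hom R T" and h: "h \<in> alg_hom R T" for T f g h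
  proof -
    note T' = fg_algebra_imp_fq_algebra[OF T]
    interpret T: fq_algebra T by (rule T')
    have u: "f b \<in> Units T" "g b \<in> Units T" "h b \<in> Units T"
      using alg_hom_Units[OF R(1) T'] f g h b(2) by auto
    have *: "g b \<otimes>\<^bsub>T\<^esub> inv\<^bsub>T\<^esub> f b \<otimes>\<^bsub>T\<^esub> (h b \<otimes>\<^bsub>T\<^esub> inv\<^bsub>T\<^esub> g b) =
        (g b \<otimes>\<^bsub>T\<^esub> inv\<^bsub>T\<^esub> g b) \<otimes>\<^bsub>T\<^esub> (h b \<otimes>\<^bsub>T\<^esub> inv\<^bsub>T\<^esub> f b)"
      using u T.Units_closed T.Units_inv_closed by (simp add: T.m_ac del: T.Units_r_inv)
    show ?thesis
      using u by (simp add: \<zeta> T f g h cobd_def * T.Units_closed)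
  qed
  ultimately show ?thesis
    unfolding cocycles_def using b(1) by blast
qed

text \<open>Equal coboundaries mean that the ratio of \<open>b\<close> and \<open>b'\<close> has the
  same image under any two points, so it descends to a scalar. All comparisons of k-th roots below
  rest on this.\<close>

lemma eq_cobd_unit_descends:
  assumes "fppf_cover R" "b \<in> Units R" "b' \<in> Units R"
    and "\<And>T f g. fg_algebra T \<Longrightarrow> f \<in> alg_hom R T \<Longrightarrow> g \<in> alg_hom R T \<Longrightarrow> cobd b T f g = cobd b' T f g"
  obtains c where "c \<noteq> 0" "b = emb R c \<otimes>\<^bsub>R\<^esub> b'"
proof -
  note R = fppf_coverD[OF assms(1)]
  interpret R: fq_algebra R by (rule R)
  have "b \<otimes>\<^bsub>R\<^esub> inv\<^bsub>R\<^esub> b' \<in> range (emb R)"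
  proof (rule descent_of_elements[OF assms(1)])
    show "b \<otimes>\<^bsub>R\<^esub> inv\<^bsub>R\<^esub> b' \<in> carrier R" using assms by auto
    fix T :: "'a falg" and f g
    assume T: "fg_algebra T" and f: "f \<in> alg_hom R T" and g: "g \<in> alg_hom R T"
    note T' = fg_algebra_imp_fq_algebra[OF T]
    interpret T: fq_algebra T by (rule T')
    have u: "f b \<in> Units T" "g b \<in> Units T" "f b' \<in> Units T" "g b' \<in> Units T"
      using alg_hom_Units[OF R(1) T'] f g assms(2,3) by auto
    have "g b \<otimes>\<^bsub>T\<^esub> inv\<^bsub>T\<^esub> f b = g b' \<otimes>\<^bsub>T\<^esub> inv\<^bsub>T\<^esub> f b'"
      using assms(4)[OF T f g] by (simp add: cobd_def)
    then have "g b \<otimes>\<^bsub>T\<^esub> inv\<^bsub>T\<^esub> g b' = f b \<otimes>\<^bsub>T\<^esub> inv\<^bsub>T\<^esub> f b'"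
      using T.Units_ratio_eq_iff[OF u(2,1,4,3)] by simp
    then show "f (b \<otimes>\<^bsub>R\<^esub> inv\<^bsub>R\<^esub> b') = g (b \<otimes>\<^bsub>R\<^esub> inv\<^bsub>R\<^esub> b')"
      using assms(2,3) alg_hom_mult[OF R(1) T'] alg_hom_inv[OF R(1) T'] f g by auto
  qed
  then obtain c where c: "b \<otimes>\<^bsub>R\<^esub> inv\<^bsub>R\<^esub> b' = emb R c" by blast
  have "b = (b \<otimes>\<^bsub>R\<^esub> inv\<^bsub>R\<^esub> b') \<otimes>\<^bsub>R\<^esub> b'"
    using assms(2,3) by (simp add: R.m_assoc R.Units_closed)
  then have eq: "b = emb R c \<otimes>\<^bsub>R\<^esub> b'" using c by simp
  have "c \<noteq> 0"
  proof
    assume "c = 0"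
    then have "b = \<zero>\<^bsub>R\<^esub>" using eq assms(3) by (simp add: R.Units_closed)
    then show False using assms(2) R(3) by (metis R.Units_r_inv R.l_null R.Units_inv_closed)
  qed
  then show ?thesis using eq that by blast
qed

lemma ex_kummer_class:
  assumes "(R, \<zeta>) \<in> cocycles k" "k > 0"
  obtains a where "a \<noteq> 0" "(R, \<zeta>) \<in> kummer_class k a"
proof -
  have cov: "fppf_cover R" using cocycle_cover[OF assms] .
  note R = fppf_coverD[OF cov]
  interpret R: fq_algebra R by (rule R)
  obtain b where b: "b \<in> Units R"
    and \<zeta>: "\<And>T f g. fg_algebra T \<Longrightarrow> f \<in> alg_hom R T \<Longrightarrow> g \<in> alg_hom R T \<Longrightarrow> \<zeta> T f g = cobd b T f g"
    using cocycle_eq_cobd[OF assms] by metis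
  have "cobd (b [^]\<^bsub>R\<^esub> k) T f g = cobd \<one>\<^bsub>R\<^esub> T f g"
    if T: "fg_algebra T" and f: "f \<in> alg_hom R T" and g: "g \<in> alg_hom R T" for T f g
    using cocycle_mu[OF assms T f g] cobd_power[OF R(1) fg_algebra_imp_fq_algebra[OF T] f g b, of k]
      cobd_emb[OF R(1) fg_algebra_imp_fq_algebra[OF T] f g, of 1]
    by (simp add: \<zeta>[OF T f g] mu_def)
  then obtain c where "c \<noteq> 0" "b [^]\<^bsub>R\<^esub> k = emb R c \<otimes>\<^bsub>R\<^esub> \<one>\<^bsub>R\<^esub>"
    using eq_cobd_unit_descends[OF cov R.Units_power[OF b] R.Units_one_closed] by blast
  then show ?thesis
    using that[of c] kummer_classI[OF cov b] \<zeta> by simp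
qed

text \<open>Rescaling the root \<open>b\<close> by a scalar \<open>c\<close> multiplies its k-th
  power by \<open>c ^ k\<close> but leaves its coboundary alone.\<close>

lemma kummer_class_mult_power:
  assumes "(R, \<zeta>) \<in> kummer_class k a" "c \<noteq> 0"
  shows "(R, \<zeta>) \<in> kummer_class k (a * c ^ k)"
proof -
  obtain b where b: "fppf_cover R" "b \<in> Units R" "b [^]\<^bsub>R\<^esub> k = emb R a"
    and \<zeta>: "\<And>T f g. fg_algebra T \<Longrightarrow> f \<in> alg_hom R T \<Longrightarrow> g \<in> alg_hom R T \<Longrightarrow> \<zeta> T f g = cobd b T f g"
    using assms(1) by (rule kummer_classE) blast
  note R = fppf_coverD[OF b(1)]
  interpret R: fq_algebra R by (rule R)
  have c: "emb R c \<in> Units R" by (rule R.emb_Units[OF assms(2)])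
  show ?thesis
  proof (rule kummer_classI[OF b(1), of "b \<otimes>\<^bsub>R\<^esub> emb R c"])
    show "b \<otimes>\<^bsub>R\<^esub> emb R c \<in> Units R" using b c by simp
    show "(b \<otimes>\<^bsub>R\<^esub> emb R c) [^]\<^bsub>R\<^esub> k = emb R (a * c ^ k)"
      using b by (simp add: R.nat_pow_distrib R.Units_closed R.emb_mult R.emb_power)
    fix T :: "'a falg" and f g
    assume T: "fg_algebra T" and f: "f \<in> alg_hom R T" and g: "g \<in> alg_hom R T"
    note T' = fg_algebra_imp_fq_algebra[OF T]
    interpret T: fq_algebra T by (rule T')
    show "\<zeta> T f g = cobd (b \<otimes>\<^bsub>R\<^esub> emb R c) T f g"
      using cobd_closed[OF R(1) T' f g b(2)]
      by (simp add: \<zeta>[OF T f g] cobd_mult[OF R(1) T' f g b(2) c] cobd_emb[OF R(1) T' f g assms(2)]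
          T.Units_closed)
  qed
qed

lemma kummer_class_eqD:
  assumes "(R, \<zeta>) \<in> kummer_class k a" "(R, \<zeta>) \<in> kummer_class k a'"
  obtains c where "c \<noteq> 0" "a = a' * c ^ k"
proof -
  obtain b where b: "fppf_cover R" "b \<in> Units R" "b [^]\<^bsub>R\<^esub> k = emb R a"
    "\<And>T f g. fg_algebra T \<Longrightarrow> f \<in> alg_hom R T \<Longrightarrow> g \<in> alg_hom R T \<Longrightarrow> \<zeta> T f g = cobd b T f g"
    using assms(1) by (rule kummer_classE) blast
  obtain b' where b': "b' \<in> Units R" "b' [^]\<^bsub>R\<^esub> k = emb R a'"
    "\<And>T f g. fg_algebra T \<Longrightarrow> f \<in> alg_hom R T \<Longrightarrow> g \<in> alg_hom R T \<Longrightarrow> \<zeta> T f g = cobd b' T f g"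
    using assms(2) by (rule kummer_classE) blast
  note R = fppf_coverD[OF b(1)]
  interpret R: fq_algebra R by (rule R)
  obtain c where c: "c \<noteq> 0" "b = emb R c \<otimes>\<^bsub>R\<^esub> b'"
    using eq_cobd_unit_descends[OF b(1,2) b'(1)] b(4) b'(3) by metis
  have "emb R a = emb R (a' * c ^ k)"
    using b(3) b'(1,2) c(2)
    by (simp add: R.nat_pow_distrib R.Units_closed R.emb_mult R.emb_power R.m_comm)
  then show ?thesis
    using that c(1) R.emb_eq_iff[OF R(3)] by blast
qed

lemma kummer_class_mult:
  assumes "(R, \<zeta>) \<in> kummer_class k a" "(R, \<eta>) \<in> kummer_class k a'"
  shows "(R, \<lambda>T f g. \<zeta> T f g \<otimes>\<^bsub>T\<^esub> \<eta> T f g) \<in> kummer_class k (a * a')"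
proof -
  obtain b where b: "fppf_cover R" "b \<in> Units R" "b [^]\<^bsub>R\<^esub> k = emb R a"
    "\<And>T f g. fg_algebra T \<Longrightarrow> f \<in> alg_hom R T \<Longrightarrow> g \<in> alg_hom R T \<Longrightarrow> \<zeta> T f g = cobd b T f g"
    using assms(1) by (rule kummer_classE) blast
  obtain b' where b': "b' \<in> Units R" "b' [^]\<^bsub>R\<^esub> k = emb R a'"
    "\<And>T f g. fg_algebra T \<Longrightarrow> f \<in> alg_hom R T \<Longrightarrow> g \<in> alg_hom R T \<Longrightarrow> \<eta> T f g = cobd b' T f g"
    using assms(2) by (rule kummer_classE) blast
  note R = fppf_coverD[OF b(1)]
  interpret R: fq_algebra R by (rule R)
  show ?thesis
  proof (rule kummer_classI[OF b(1), of "b \<otimes>\<^bsub>R\<^esub> b'"])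
    show "b \<otimes>\<^bsub>R\<^esub> b' \<in> Units R" using b b' by simp
    show "(b \<otimes>\<^bsub>R\<^esub> b') [^]\<^bsub>R\<^esub> k = emb R (a * a')"
      using b b' by (simp add: R.nat_pow_distrib R.Units_closed R.emb_mult)
  qed (simp add: b(4) b'(3) cobd_mult[OF R(1) fg_algebra_imp_fq_algebra _ _ b(2) b'(1)])
qed

lemma cobd_in_kummer_class:
  "fppf_cover R \<Longrightarrow> b \<in> Units R \<Longrightarrow> b [^]\<^bsub>R\<^esub> k = emb R a \<Longrightarrow> (R, cobd b) \<in> kummer_class k a"
  by (rule kummer_classI) auto

text \<open>The image of a k-th root of \<open>a\<close> is a k-th root of \<open>a\<close> over the
  finer covering. This brings classes given on different coverings to a common one.\<close>

lemma kummer_class_pullback: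
  assumes "(R, \<zeta>) \<in> kummer_class k a" "fppf_cover S" "r \<in> alg_hom R S"
  obtains b where "b \<in> Units S" "b [^]\<^bsub>S\<^esub> k = emb S a"
    "\<And>T f g. fg_algebra T \<Longrightarrow> f \<in> alg_hom S T \<Longrightarrow> g \<in> alg_hom S T \<Longrightarrow>
      \<zeta> T (compose (carrier R) f r) (compose (carrier R) g r) = cobd b T f g"
proof -
  obtain b where b: "fppf_cover R" "b \<in> Units R" "b [^]\<^bsub>R\<^esub> k = emb R a"
    and \<zeta>: "\<And>T f g. fg_algebra T \<Longrightarrow> f \<in> alg_hom R T \<Longrightarrow> g \<in> alg_hom R T \<Longrightarrow> \<zeta> T f g = cobd b T f g"
    using assms(1) by (rule kummer_classE) blast
  note R = fppf_coverD[OF b(1)]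
  note S = fppf_coverD[OF assms(2)]
  interpret R: fq_algebra R by (rule R)
  show ?thesis
  proof
    show "r b \<in> Units S" by (rule alg_hom_Units[OF R(1) S(1) assms(3) b(2)])
    show "r b [^]\<^bsub>S\<^esub> k = emb S a"
      using alg_hom_power[OF R(1) S(1) assms(3), of b k] b(2,3) alg_hom_emb[OF R(1) S(1) assms(3)]
      by (simp add: R.Units_closed)
    fix T :: "'a falg" and f g
    assume T: "fg_algebra T" and f: "f \<in> alg_hom S T" and g: "g \<in> alg_hom S T"
    note T' = fg_algebra_imp_fq_algebra[OF T]
    show "\<zeta> T (compose (carrier R) f r) (compose (carrier R) g r) = cobd (r b) T f g"
      using \<zeta>[OF T alg_hom_compose[OF R(1) S(1) T' assms(3) f] alg_hom_compose[OF R(1) S(1) T' assms(3) g]]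
        b(2) by (simp add: cobd_compose R.Units_closed)
  qed
qed

text \<open>Over the tensor product of the two coverings both cocycles come from k-th roots of the
  same \<open>a\<close>. The ratio of these roots is a root of unity, and its coboundary is the
  difference of the cocycles.\<close>

lemma kummer_class_imp_cohomologous:
  assumes "(R, \<zeta>) \<in> kummer_class k a" "(R', \<zeta>') \<in> kummer_class k a" "a \<noteq> 0"
  shows "((R, \<zeta>), (R', \<zeta>')) \<in> cohomologous k"
proof -
  have cov: "fppf_cover R" "fppf_cover R'"
    using assms by (auto elim: kummer_classE)
  define S where "S = tensor R R'"
  note R = fppf_coverD[OF cov(1)] and R' = fppf_coverD[OF cov(2)]
  have covS: "fppf_cover S" unfolding S_def by (rule fppf_cover_tensor[OF cov])
  note S = fppf_coverD[OF covS]
  interpret S: fq_algebra S by (rule S)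
  have i: "in1 R R' \<in> alg_hom R S" "in2 R R' \<in> alg_hom R' S"
    unfolding S_def by (rule in1_alg_hom[OF R(1) R'(1)] in2_alg_hom[OF R(1) R'(1)])+
  obtain b where b: "b \<in> Units S" "b [^]\<^bsub>S\<^esub> k = emb S a"
    and \<zeta>: "\<And>T f g. fg_algebra T \<Longrightarrow> f \<in> alg_hom S T \<Longrightarrow> g \<in> alg_hom S T \<Longrightarrow>
      \<zeta> T (compose (carrier R) f (in1 R R')) (compose (carrier R) g (in1 R R')) = cobd b T f g"
    using kummer_class_pullback[OF assms(1) covS i(1)] by metis
  obtain b' where b': "b' \<in> Units S" "b' [^]\<^bsub>S\<^esub> k = emb S a"
    and \<zeta>': "\<And>T f g. fg_algebra T \<Longrightarrow> f \<in> alg_hom S T \<Longrightarrow> g \<in> alg_hom S T \<Longrightarrow>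
      \<zeta>' T (compose (carrier R') f (in2 R R')) (compose (carrier R') g (in2 R R')) = cobd b' T f g"
    using kummer_class_pullback[OF assms(2) covS i(2)] by metis
  define d where "d = b' \<otimes>\<^bsub>S\<^esub> inv\<^bsub>S\<^esub> b"
  have du: "d \<in> Units S" using b b' by (simp add: d_def)
  have bd: "b' = b \<otimes>\<^bsub>S\<^esub> d"
    using b b' S.m_lcomm[of b b' "inv\<^bsub>S\<^esub> b"] by (simp add: d_def S.Units_closed)
  have "d [^]\<^bsub>S\<^esub> k = emb S a \<otimes>\<^bsub>S\<^esub> inv\<^bsub>S\<^esub> emb S a"
    using b b' by (simp add: d_def S.nat_pow_distrib S.Units_closed flip: S.inv_power_Units)
  then have "d \<in> mu k S"
    using du S.emb_Units[OF assms(3)] by (simp add: mu_def S.Units_closed)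
  moreover have "\<zeta>' T (compose (carrier R') f (in2 R R')) (compose (carrier R') g (in2 R R')) =
      \<zeta> T (compose (carrier R) f (in1 R R')) (compose (carrier R) g (in1 R R')) \<otimes>\<^bsub>T\<^esub> cobd d T f g"
    if T: "fg_algebra T" and f: "f \<in> alg_hom S T" and g: "g \<in> alg_hom S T" for T f g
    unfolding \<zeta>[OF that] \<zeta>'[OF that] bd
    by (rule cobd_mult[OF S(1) fg_algebra_imp_fq_algebra[OF T] f g b(1) du])
  ultimately show ?thesis
    unfolding cohomologous_def
    using kummer_class_subset_cocycles[OF assms(1,3)] kummer_class_subset_cocycles[OF assms(2,3)] covS i
    by blast
qed

text \<open>The second cocycle belongs to some scalar \<open>a'\<close>. Over the common refinement,
  \<open>b\<close> times the root of unity \<open>d\<close> has the coboundary of \<open>b'\<close>,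
  so they differ by a scalar; since \<open>d\<close> disappears in k-th powers, \<open>a\<close> and
  \<open>a'\<close> differ by a k-th power.\<close>

lemma cohomologous_imp_kummer_class:
  assumes "((R, \<zeta>), (R', \<zeta>')) \<in> cohomologous k" "(R, \<zeta>) \<in> kummer_class k a" "k > 0"
  shows "(R', \<zeta>') \<in> kummer_class k a"
proof -
  obtain S r r' d where cov: "fppf_cover S" and r: "r \<in> alg_hom R S" "r' \<in> alg_hom R' S"
    and d: "d \<in> mu k S"
    and eq: "\<And>T f g. fg_algebra T \<Longrightarrow> f \<in> alg_hom S T \<Longrightarrow> g \<in> alg_hom S T \<Longrightarrow>
      \<zeta>' T (compose (carrier R') f r') (compose (carrier R') g r') =
      \<zeta> T (compose (carrier R) f r) (compose (carrier R) g r) \<otimes>\<^bsub>T\<^esub> cobd d T f g"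
    and cc: "(R', \<zeta>') \<in> cocycles k"
    using assms(1) unfolding cohomologous_def by blast
  note S = fppf_coverD[OF cov]
  interpret S: fq_algebra S by (rule S)
  obtain a' where a': "a' \<noteq> 0" "(R', \<zeta>') \<in> kummer_class k a'"
    using ex_kummer_class[OF cc assms(3)] by blast
  obtain b where b: "b \<in> Units S" "b [^]\<^bsub>S\<^esub> k = emb S a"
    and \<zeta>: "\<And>T f g. fg_algebra T \<Longrightarrow> f \<in> alg_hom S T \<Longrightarrow> g \<in> alg_hom S T \<Longrightarrow>
      \<zeta> T (compose (carrier R) f r) (compose (carrier R) g r) = cobd b T f g"
    using kummer_class_pullback[OF assms(2) cov r(1)] by metis
  obtain b' where b': "b' \<in> Units S" "b' [^]\<^bsub>S\<^esub> k = emb S a'"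
    and \<zeta>': "\<And>T f g. fg_algebra T \<Longrightarrow> f \<in> alg_hom S T \<Longrightarrow> g \<in> alg_hom S T \<Longrightarrow>
      \<zeta>' T (compose (carrier R') f r') (compose (carrier R') g r') = cobd b' T f g"
    using kummer_class_pullback[OF a'(2) cov r(2)] by metis
  have du: "d \<in> Units S" and dk: "d [^]\<^bsub>S\<^esub> k = \<one>\<^bsub>S\<^esub>"
    using d assms(3) S.Units_if_power_Units[of d k] by (auto simp: mu_def)
  have "cobd (b \<otimes>\<^bsub>S\<^esub> d) T f g = cobd b' T f g"
    if T: "fg_algebra T" and f: "f \<in> alg_hom S T" and g: "g \<in> alg_hom S T" for T f g
    using eq[OF that] cobd_mult[OF S(1) fg_algebra_imp_fq_algebra[OF T] f g b(1) du]
    by (simp add: \<zeta>[OF that] \<zeta>'[OF that])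
  then obtain c where c: "c \<noteq> 0" "b \<otimes>\<^bsub>S\<^esub> d = emb S c \<otimes>\<^bsub>S\<^esub> b'"
    using eq_cobd_unit_descends[OF cov S.Units_m_closed[OF b(1) du] b'(1)] by blast
  have "(b \<otimes>\<^bsub>S\<^esub> d) [^]\<^bsub>S\<^esub> k = emb S a"
    using b du dk by (simp add: S.nat_pow_distrib S.Units_closed)
  moreover have "(emb S c \<otimes>\<^bsub>S\<^esub> b') [^]\<^bsub>S\<^esub> k = emb S (a' * c ^ k)"
    using b' by (simp add: S.nat_pow_distrib S.Units_closed S.emb_mult S.emb_power S.m_comm)
  ultimately have "a = a' * c ^ k"
    using S.emb_eq_iff[OF S(3)] c(2) by metis
  then show ?thesis
    using kummer_class_mult_power[OF a'(2) c(1)] by simp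
qed

section \<open>The subring of the algebraic closure generated by one element, as a covering\<close>

definition adjoin :: "'a::{field,finite} alg_closure \<Rightarrow> 'a list \<Rightarrow> 'a alg_closure" where
  "adjoin z xs = foldr (\<lambda>c y. to_ac c + z * y) xs 0"

lemma adjoin_Nil [simp]: "adjoin z [] = 0"
  and adjoin_Cons [simp]: "adjoin z (c # xs) = to_ac c + z * adjoin z xs"
  by (simp_all add: adjoin_def)

text \<open>One step of Horner's rule, by which \<open>adjoin\<close> evaluates a coefficient list
  at \<open>z\<close>. The closure properties of the subring are proved by iterating it.\<close>

lemma adjoin_gen: "x \<in> range (adjoin z) \<Longrightarrow> to_ac c + z * x \<in> range (adjoin z)"
proof -
  assume "x \<in> range (adjoin z)"
  then obtain xs where "x = adjoin z xs" by blast
  then show ?thesis by (intro image_eqI[of _ _ "c # xs"]) simp_all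
qed

lemma adjoin_zero: "0 \<in> range (adjoin z)"
  by (rule image_eqI[of _ _ "[]"]) simp_all

lemma adjoin_to_ac: "to_ac c \<in> range (adjoin z)"
  using adjoin_gen[OF adjoin_zero, of c z] by simp

lemma adjoin_self: "z \<in> range (adjoin z)"
  using adjoin_gen[OF adjoin_to_ac, of 0 z 1] by simp

lemma adjoin_add:
  assumes "x \<in> range (adjoin z)" "y \<in> range (adjoin z)"
  shows "x + y \<in> range (adjoin z)"
proof -
  have "adjoin z xs + adjoin z ys \<in> range (adjoin z)" for xs ys
  proof (induction xs arbitrary: ys)
    case (Cons c xs)
    show ?case
    proof (cases ys)
      case Nil
      then show ?thesis by (simp del: adjoin_Cons)
    next
      case (Cons d ys')
      have "to_ac (c + d) + z * (adjoin z xs + adjoin z ys') \<in> range (adjoin z)"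
        by (intro adjoin_gen Cons.IH)
      then show ?thesis by (simp add: Cons algebra_simps)
    qed
  qed simp
  then show ?thesis using assms by auto
qed

lemma adjoin_mult:
  assumes "x \<in> range (adjoin z)" "y \<in> range (adjoin z)"
  shows "x * y \<in> range (adjoin z)"
proof -
  have scale: "to_ac c * adjoin z ys \<in> range (adjoin z)" for c ys
  proof (induction ys)
    case (Cons d ys)
    have "to_ac (c * d) + z * (to_ac c * adjoin z ys) \<in> range (adjoin z)"
      by (intro adjoin_gen Cons.IH)
    then show ?case by (simp add: algebra_simps)
  qed (simp add: adjoin_zero)
  have "adjoin z xs * adjoin z ys \<in> range (adjoin z)" for xs ys
  proof (induction xs)
    case (Cons c xs)
    have "to_ac c * adjoin z ys + (to_ac 0 + z * (adjoin z xs * adjoin z ys)) \<in> range (adjoin z)"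
      by (intro adjoin_add adjoin_gen scale Cons.IH)
    then show ?case by (simp add: algebra_simps)
  qed (simp add: adjoin_zero)
  then show ?thesis using assms by auto
qed

lemma adjoin_uminus: "x \<in> range (adjoin z) \<Longrightarrow> - x \<in> range (adjoin z)"
  using adjoin_mult[OF adjoin_to_ac[of "-1"]] by simp

definition code_ac :: "'a::{field,finite} alg_closure \<Rightarrow> 'a alg_closure \<Rightarrow> nat" where
  "code_ac z = to_nat_on (range (adjoin z))"

definition decode_ac :: "'a::{field,finite} alg_closure \<Rightarrow> nat \<Rightarrow> 'a alg_closure" where
  "decode_ac z = from_nat_into (range (adjoin z))"

text \<open>Transport of structure: the subring is countable, being indexed by lists, and is moved
  to the naturals because the carrier of an \<open>falg\<close> must live there.\<close>

definition adjoin_algebra :: "'a::{field,finite} alg_closure \<Rightarrow> 'a falg" where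
  "adjoin_algebra z = \<lparr>carrier = code_ac z ` range (adjoin z),
     monoid.mult = (\<lambda>m n. code_ac z (decode_ac z m * decode_ac z n)),
     one = code_ac z 1,
     zero = code_ac z 0,
     add = (\<lambda>m n. code_ac z (decode_ac z m + decode_ac z n)),
     emb = (\<lambda>c. code_ac z (to_ac c))\<rparr>"

lemma decode_code_ac [simp]: "x \<in> range (adjoin z) \<Longrightarrow> decode_ac z (code_ac z x) = x"
  unfolding decode_ac_def code_ac_def by (rule from_nat_into_to_nat_on) auto

lemma adjoin_algebra_simps:
  "carrier (adjoin_algebra z) = code_ac z ` range (adjoin z)"
  "\<one>\<^bsub>adjoin_algebra z\<^esub> = code_ac z 1"
  "\<zero>\<^bsub>adjoin_algebra z\<^esub> = code_ac z 0"
  "emb (adjoin_algebra z) c = code_ac z (to_ac c)"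
  "x \<in> range (adjoin z) \<Longrightarrow> y \<in> range (adjoin z) \<Longrightarrow>
    code_ac z x \<otimes>\<^bsub>adjoin_algebra z\<^esub> code_ac z y = code_ac z (x * y)"
  "x \<in> range (adjoin z) \<Longrightarrow> y \<in> range (adjoin z) \<Longrightarrow>
    code_ac z x \<oplus>\<^bsub>adjoin_algebra z\<^esub> code_ac z y = code_ac z (x + y)"
  by (simp_all add: adjoin_algebra_def)

lemma adjoin_one: "1 \<in> range (adjoin z)"
  using adjoin_to_ac[of 1 z] by simp

lemma fppf_cover_adjoin_algebra: "fppf_cover (adjoin_algebra z)"
proof -
  let ?R = "adjoin_algebra z"
  note [simp] = adjoin_algebra_simps adjoin_add adjoin_mult adjoin_zero adjoin_one adjoin_to_ac
  have "cring ?R"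
  proof (rule cringI)
    show "abelian_group ?R"
    proof (rule abelian_groupI)
      fix x assume "x \<in> carrier ?R"
      then obtain u where "x = code_ac z u" "u \<in> range (adjoin z)"
        by (auto simp del: image_iff)
      then show "\<exists>y\<in>carrier ?R. y \<oplus>\<^bsub>?R\<^esub> x = \<zero>\<^bsub>?R\<^esub>"
        using adjoin_uminus[of u z] by (intro bexI[of _ "code_ac z (- u)"]) auto
    qed (auto simp: algebra_simps simp del: range_eqI)
    show "Group.comm_monoid ?R"
      by (rule comm_monoidI) (auto simp: algebra_simps)
  qed (auto simp: algebra_simps)
  moreover have "emb ?R \<in> ring_hom ring_of_type_algebra ?R"
    by (rule ring_hom_memI) (auto simp: ring_of_type_algebra_def)
  ultimately have fq: "fq_algebra ?R"
    by (simp add: fq_algebra_def fq_algebra_axioms_def)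
  interpret R: fq_algebra ?R by (rule fq)
  \<comment> \<open>Finite type with the single generator \<open>z\<close>: each step of Horner's
    rule is one addition and one multiplication in the generated ring.\<close>
  have "code_ac z (adjoin z xs) \<in> generate_ring ?R (range (emb ?R) \<union> {code_ac z z})" for xs
  proof (induction xs)
    case Nil
    then show ?case using R.zero_in_generate by simp
  next
    case (Cons c xs)
    have "emb ?R c \<oplus>\<^bsub>?R\<^esub> code_ac z z \<otimes>\<^bsub>?R\<^esub> code_ac z (adjoin z xs) \<in>
        generate_ring ?R (range (emb ?R) \<union> {code_ac z z})"
      by (intro generate_ring.eng_add generate_ring.eng_mult Cons.IH generate_ring.incl) auto
    then show ?case by (simp add: adjoin_self)
  qed
  moreover have "generate_ring ?R (range (emb ?R) \<union> {code_ac z z}) \<subseteq> carrier ?R"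
    by (intro R.generate_ring_incl) (use adjoin_self in auto)
  ultimately have "generate_ring ?R (range (emb ?R) \<union> {code_ac z z}) = carrier ?R"
    by auto
  then have "fg_algebra ?R"
    unfolding fg_algebra_def using R.is_cring R.emb_hom adjoin_self[of z]
    by (auto intro!: exI[of _ "{code_ac z z}"])
  moreover have "code_ac z 1 \<noteq> code_ac z 0"
    using decode_code_ac[OF adjoin_one, of z] decode_code_ac[OF adjoin_zero, of z] by force
  ultimately show ?thesis
    by (simp add: fppf_cover_def)
qed

text \<open>Supplies a covering over which \<open>a\<close> becomes a k-th power. Using a root in
  the closure, instead of a quotient of a polynomial ring, makes it evident that the algebra is
  nonzero.\<close>

lemma ex_kummer_cover:
  fixes a :: "'a::{field,finite}" and k :: nat
  assumes "a \<noteq> 0" "k > 0"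
  obtains R :: "'a falg" and l where "fppf_cover R" "l \<in> Units R" "l [^]\<^bsub>R\<^esub> k = emb R a"
proof -
  obtain z where z: "z ^ k = to_ac a"
    using nth_root_exists[OF assms(2)] by blast
  note cov = fppf_cover_adjoin_algebra[of z]
  interpret R: fq_algebra "adjoin_algebra z" by (rule fppf_coverD[OF cov])
  have "code_ac z z [^]\<^bsub>adjoin_algebra z\<^esub> n = code_ac z (z ^ n) \<and> z ^ n \<in> range (adjoin z)" for n :: nat
    by (induction n)
      (simp_all add: adjoin_algebra_simps adjoin_one adjoin_self adjoin_mult mult.commute)
  then have "code_ac z z [^]\<^bsub>adjoin_algebra z\<^esub> k = emb (adjoin_algebra z) a"
    by (simp add: z adjoin_algebra_simps)
  moreover from this have "code_ac z z \<in> Units (adjoin_algebra z)"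
    using R.Units_if_power_Units[of "code_ac z z" k] R.emb_Units[OF assms(1)] assms(2) adjoin_self[of z]
    by (simp add: adjoin_algebra_simps)
  ultimately show ?thesis
    using that cov by blast
qed

section \<open>The group structure of the first cohomology\<close>

lemma kummer_class_nonempty:
  assumes "a \<noteq> 0" "k > 0"
  shows "kummer_class k a \<noteq> {}"
  using ex_kummer_cover[OF assms] cobd_in_kummer_class by (metis empty_iff)

text \<open>Any nonempty part of a Kummer class generates all of it. With a singleton this computes
  the elements of the quotient; with the sets of product and constant cocycles it evaluates the
  operations of \<open>H1_mu\<close>.\<close>

lemma cohomologous_Image:
  assumes "Q \<subseteq> kummer_class k a" "Q \<noteq> {}" "a \<noteq> 0" "k > 0"
  shows "cohomologous k `` Q = kummer_class k a"
proof (intro equalityI subsetI)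
  fix y assume "y \<in> cohomologous k `` Q"
  then obtain x where "x \<in> Q" "(x, y) \<in> cohomologous k" by blast
  then show "y \<in> kummer_class k a"
    using assms cohomologous_imp_kummer_class by (cases x, cases y) blast
next
  fix y assume y: "y \<in> kummer_class k a"
  obtain x where "x \<in> Q" using assms by blast
  then have "(x, y) \<in> cohomologous k"
    using assms y kummer_class_imp_cohomologous by (cases x, cases y) blast
  then show "y \<in> cohomologous k `` Q"
    using \<open>x \<in> Q\<close> by blast
qed

text \<open>The kernel of the Kummer map consists exactly of the k-th powers.\<close>

lemma kummer_class_eq_iff:
  assumes "a \<noteq> 0" "a' \<noteq> 0" "k > 0"
  shows "kummer_class k a = kummer_class k a' \<longleftrightarrow> (\<exists>c. c \<noteq> 0 \<and> a = a' * c ^ k)"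
proof
  assume "kummer_class k a = kummer_class k a'"
  moreover obtain R \<zeta> where "(R, \<zeta>) \<in> kummer_class k a"
    using kummer_class_nonempty[OF assms(1,3)] by auto
  ultimately show "\<exists>c. c \<noteq> 0 \<and> a = a' * c ^ k"
    using kummer_class_eqD by metis
next
  assume "\<exists>c. c \<noteq> 0 \<and> a = a' * c ^ k"
  then obtain c where c: "c \<noteq> 0" "a = a' * c ^ k" by blast
  then have eq: "a * (inverse c) ^ k = a'"
    by (simp add: field_simps)
  show "kummer_class k a = kummer_class k a'"
  proof (intro equalityI subrelI)
    fix R \<zeta>
    show "(R, \<zeta>) \<in> kummer_class k a'" if "(R, \<zeta>) \<in> kummer_class k a"
      using kummer_class_mult_power[OF that, of "inverse c"] c(1) unfolding eq by simp
    show "(R, \<zeta>) \<in> kummer_class k a" if "(R, \<zeta>) \<in> kummer_class k a'"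
      using kummer_class_mult_power[OF that c(1)] c(2) by simp
  qed
qed

text \<open>Surjectivity of the Kummer map, by \<open>ex_kummer_class\<close>; conversely, no Kummer
  class is empty.\<close>

lemma carrier_H1_mu:
  assumes "k > 0"
  shows "carrier (H1_mu k) = kummer_class k ` {a. a \<noteq> 0}"
proof (intro equalityI subsetI)
  fix c :: "('a falg \<times> 'a cochain) set" assume "c \<in> carrier (H1_mu k)"
  then obtain R \<zeta> where R: "(R, \<zeta>) \<in> cocycles k" "c = cohomologous k `` {(R, \<zeta>)}"
    by (auto simp: H1_mu_def quotient_def)
  then obtain a where "a \<noteq> 0" "(R, \<zeta>) \<in> kummer_class k a"
    using ex_kummer_class assms by metis
  then show "c \<in> kummer_class k ` {a. a \<noteq> 0}"
    using R(2) cohomologous_Image[of "{(R, \<zeta>)}" k a] assms by auto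
next
  fix c :: "('a falg \<times> 'a cochain) set" assume "c \<in> kummer_class k ` {a. a \<noteq> 0}"
  then obtain a where a: "a \<noteq> 0" "c = kummer_class k a" by auto
  obtain x where x: "x \<in> kummer_class k a"
    using kummer_class_nonempty[OF a(1) assms] by auto
  then have "x \<in> cocycles k"
    using kummer_class_subset_cocycles a(1) by (cases x) blast
  then show "c \<in> carrier (H1_mu k)"
    using cohomologous_Image[of "{x}" k a] a x assms by (auto simp: H1_mu_def quotient_def)
qed

lemma H1_mu_one:
  assumes "k > 0"
  shows "\<one>\<^bsub>H1_mu k\<^esub> = kummer_class k (1::'a::{field,finite})"
proof -
  have "(R, \<lambda>T f g. \<one>\<^bsub>T\<^esub>) \<in> kummer_class k 1" if "fppf_cover R" for R :: "'a falg"
  proof -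
    note R = fppf_coverD[OF that]
    interpret R: fq_algebra R by (rule R)
    show ?thesis
      using cobd_emb[OF R(1) fg_algebra_imp_fq_algebra, of _ _ _ 1]
      by (intro kummer_classI[OF that, of "\<one>\<^bsub>R\<^esub>"]) auto
  qed
  then have "{(R, \<lambda>T f g. \<one>\<^bsub>T\<^esub>) |R. fppf_cover R} \<subseteq> kummer_class k (1::'a)"
    by blast
  moreover have "{(R::'a falg, (\<lambda>T f g. \<one>\<^bsub>T\<^esub>)::'a cochain) |R. fppf_cover R} \<noteq> {}"
    using fppf_cover_adjoin_algebra by blast
  ultimately show ?thesis
    unfolding H1_mu_def using assms by (simp add: cohomologous_Image)
qed

text \<open>The point is that the set of product cocycles is nonempty: the two classes need
  representatives on one covering, found on the tensor product of coverings that contain the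
  respective roots.\<close>

lemma H1_mu_mult:
  assumes "a \<noteq> 0" "a' \<noteq> 0" "k > 0"
  shows "kummer_class k a \<otimes>\<^bsub>H1_mu k\<^esub> kummer_class k a' = kummer_class k (a * a')"
proof -
  obtain R l where R: "fppf_cover R" "l \<in> Units R" "l [^]\<^bsub>R\<^esub> k = emb R a"
    using ex_kummer_cover[OF assms(1,3)] by blast
  obtain R' l' where R': "fppf_cover R'" "l' \<in> Units R'" "l' [^]\<^bsub>R'\<^esub> k = emb R' a'"
    using ex_kummer_cover[OF assms(2,3)] by blast
  note S = fppf_cover_tensor[OF R(1) R'(1)]
  have i: "in1 R R' \<in> alg_hom R (tensor R R')" "in2 R R' \<in> alg_hom R' (tensor R R')"
    by (rule in1_alg_hom[OF fppf_coverD(1)[OF R(1)] fppf_coverD(1)[OF R'(1)]]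
        in2_alg_hom[OF fppf_coverD(1)[OF R(1)] fppf_coverD(1)[OF R'(1)]])+
  obtain b where "b \<in> Units (tensor R R')" "b [^]\<^bsub>tensor R R'\<^esub> k = emb (tensor R R') a"
    using kummer_class_pullback[OF cobd_in_kummer_class[OF R] S i(1)] by metis
  moreover obtain b' where "b' \<in> Units (tensor R R')" "b' [^]\<^bsub>tensor R R'\<^esub> k = emb (tensor R R') a'"
    using kummer_class_pullback[OF cobd_in_kummer_class[OF R'] S i(2)] by metis
  ultimately have "(tensor R R', cobd b) \<in> kummer_class k a" "(tensor R R', cobd b') \<in> kummer_class k a'"
    using cobd_in_kummer_class[OF S] by auto
  then have "{(R, \<lambda>T f g. \<zeta> T f g \<otimes>\<^bsub>T\<^esub> \<eta> T f g) |R \<zeta> \<eta>. (R, \<zeta>) \<in> kummer_class k a \<and>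
      (R, \<eta>) \<in> kummer_class k a'} \<noteq> {}"
    by blast
  moreover have "{(R, \<lambda>T f g. \<zeta> T f g \<otimes>\<^bsub>T\<^esub> \<eta> T f g) |R \<zeta> \<eta>. (R, \<zeta>) \<in> kummer_class k a \<and>
      (R, \<eta>) \<in> kummer_class k a'} \<subseteq> kummer_class k (a * a')"
    using kummer_class_mult by blast
  ultimately show ?thesis
    using assms unfolding H1_mu_def by (simp add: cohomologous_Image)
qed

lemma group_H1_mu:
  assumes "k > 0"
  shows "group (H1_mu k)"
proof (rule groupI)
  note simps = carrier_H1_mu[OF assms] H1_mu_one[OF assms] H1_mu_mult[OF _ _ assms]
  fix x y z :: "('a falg \<times> 'a cochain) set"
  assume "x \<in> carrier (H1_mu k)"
  then obtain a where a: "x = kummer_class k a" "a \<noteq> 0" by (auto simp: simps)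
  then show "\<one>\<^bsub>H1_mu k\<^esub> \<otimes>\<^bsub>H1_mu k\<^esub> x = x" by (simp add: simps)
  show "\<exists>y\<in>carrier (H1_mu k). y \<otimes>\<^bsub>H1_mu k\<^esub> x = \<one>\<^bsub>H1_mu k\<^esub>"
    using a by (intro bexI[of _ "kummer_class k (inverse a)"]) (auto simp: simps)
  assume "y \<in> carrier (H1_mu k)"
  then obtain b where b: "y = kummer_class k b" "b \<noteq> 0" by (auto simp: simps)
  then show "x \<otimes>\<^bsub>H1_mu k\<^esub> y \<in> carrier (H1_mu k)" using a by (auto simp: simps)
  assume "z \<in> carrier (H1_mu k)"
  then obtain c where "z = kummer_class k c" "c \<noteq> 0" by (auto simp: simps)
  then show "x \<otimes>\<^bsub>H1_mu k\<^esub> y \<otimes>\<^bsub>H1_mu k\<^esub> z = x \<otimes>\<^bsub>H1_mu k\<^esub> (y \<otimes>\<^bsub>H1_mu k\<^esub> z)"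
    using a b by (simp add: simps mult.assoc)
qed (auto simp: carrier_H1_mu[OF assms] H1_mu_one[OF assms])

section \<open>Finite fields\<close>

lemma CARD_field_gt_1: "CARD('a::{field,finite}) > 1"
proof -
  have "card {0::'a, 1} \<le> CARD('a)" by (rule card_mono) auto
  then show ?thesis by simp
qed

text \<open>Multiplication by \<open>x\<close> permutes the nonzero elements, so their product
  absorbs the factor \<open>x ^ (CARD('a) - 1)\<close>.\<close>

lemma power_CARD_minus_1: "(x::'a::{field,finite}) \<noteq> 0 \<Longrightarrow> x ^ (CARD('a) - 1) = 1"
proof -
  assume x: "x \<noteq> 0"
  have "bij_betw ((*) x) (UNIV - {0}) (UNIV - {0})"
    by (rule bij_betwI[of _ _ _ "(*) (inverse x)"]) (use x in \<open>auto simp: field_simps\<close>)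
  then have "(\<Prod>y\<in>UNIV - {0}. x * y) = (\<Prod>y\<in>UNIV - {0}. y)"
    by (rule prod.reindex_bij_betw)
  then have "x ^ (CARD('a) - 1) * (\<Prod>y\<in>UNIV - {0::'a}. y) = (\<Prod>y\<in>UNIV - {0}. y)"
    by (simp add: prod.distrib)
  then show ?thesis by simp
qed

lemma power_CARD: "(x::'a::{field,finite}) ^ CARD('a) = x"
  using power_CARD_minus_1[of x] CARD_field_gt_1[where 'a = 'a] power_minus_mult[of "CARD('a)" x]
  by (cases "x = 0") auto

text \<open>The polynomial \<open>X^q - X\<close> has at most \<open>q\<close> roots, and the
  \<open>q\<close> elements of the base field already account for them.\<close>

lemma fixed_by_frobenius:
  fixes y :: "'a::{field,finite} alg_closure"
  assumes "y ^ CARD('a) = y"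
  shows "y \<in> range to_ac"
proof -
  let ?q = "CARD('a)"
  define p :: "'a alg_closure poly" where "p = monom 1 ?q - monom 1 1"
  have "coeff p ?q = 1"
    using CARD_field_gt_1[where 'a = 'a] by (simp add: p_def)
  then have "p \<noteq> 0" by auto
  have deg: "degree p \<le> ?q"
    unfolding p_def using CARD_field_gt_1[where 'a = 'a] by (intro degree_diff_le) (auto simp: degree_monom_eq)
  have poly: "poly p x = x ^ ?q - x" for x
    by (simp add: p_def poly_monom)
  have fin: "finite {x. poly p x = 0}" by (rule poly_roots_finite[OF \<open>p \<noteq> 0\<close>])
  have sub: "range to_ac \<subseteq> {x. poly p x = 0}"
    by (auto simp: poly power_CARD simp flip: to_ac_power)
  have "card {x. poly p x = 0} \<le> ?q"
    using card_poly_roots_bound[OF \<open>p \<noteq> 0\<close>] deg by linarith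
  also have "?q = card (range (to_ac :: 'a \<Rightarrow> _))"
    by (simp add: card_image inj_to_ac)
  finally have "range to_ac = {x. poly p x = 0}"
    by (intro card_seteq fin sub)
  then show ?thesis using assms poly by auto
qed

lemma ex_primitive_element:
  obtains g :: "'a::{field,finite}" where "g \<noteq> 0" "\<And>x. x \<noteq> 0 \<Longrightarrow> \<exists>i. x = g ^ i"
    "\<And>i j. g ^ i = g ^ j \<longleftrightarrow> [i = j] (mod (CARD('a) - 1))"
proof -
  let ?F = "ring_of_type_algebra :: 'a ring"
  let ?n = "CARD('a) - 1"
  have "?n > 0" using CARD_field_gt_1[where 'a = 'a] by simp
  have pow: "x [^]\<^bsub>?F\<^esub> (i::nat) = x ^ i" for x i
    by (induction i) (simp_all add: ring_of_type_algebra_def nat_pow_def mult.commute)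
  have "finite (carrier ?F)" by (simp add: ring_of_type_algebra_def)
  from field.finite_field_mult_group_has_gen[OF field_from_type_algebra this]
  obtain g where gen: "g \<in> carrier (Multiplicative_Group.mult_of ?F)"
    "carrier (Multiplicative_Group.mult_of ?F) = {g [^]\<^bsub>?F\<^esub> i |i::nat. i \<in> UNIV}"
    by blast
  have g: "g \<noteq> 0" "UNIV - {0} = range (\<lambda>i. g ^ i)"
    using gen unfolding pow by (auto simp: ring_of_type_algebra_def)
  have mod: "g ^ (i mod ?n) = g ^ i" for i
  proof -
    have "g ^ i = g ^ (?n * (i div ?n) + i mod ?n)" by simp
    also have "\<dots> = g ^ (i mod ?n)"
      unfolding power_add power_mult power_CARD_minus_1[OF g(1)] by simp
    finally show ?thesis by simp
  qed
  \<comment> \<open>The exponents below \<open>q - 1\<close> already yield all \<open>q - 1\<close>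
    nonzero elements, so their powers are distinct by counting.\<close>
  have "(\<lambda>i. g ^ i) ` {0..<?n} = UNIV - {0}"
  proof
    show "UNIV - {0} \<subseteq> (\<lambda>i. g ^ i) ` {0..<?n}"
    proof
      fix x assume "x \<in> UNIV - {0::'a}"
      then obtain i where "x = g ^ i" using g(2) by auto
      then show "x \<in> (\<lambda>i. g ^ i) ` {0..<?n}"
        using mod[of i] \<open>?n > 0\<close> by (intro image_eqI[of _ _ "i mod ?n"]) auto
    qed
  qed (use g(1) in auto)
  then have "card ((\<lambda>i. g ^ i) ` {0..<?n}) = card {0..<?n}"
    by simp
  then have inj: "inj_on (\<lambda>i. g ^ i) {0..<?n}"
    by (intro eq_card_imp_inj_on) auto
  have "g ^ i = g ^ j \<longleftrightarrow> [i = j] (mod ?n)" for i j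
  proof -
    have "i mod ?n \<in> {0..<?n}" "j mod ?n \<in> {0..<?n}" using \<open>?n > 0\<close> by auto
    from inj_on_eq_iff[OF inj this] show ?thesis unfolding mod cong_def .
  qed
  moreover have "\<exists>i. x = g ^ i" if "x \<noteq> 0" for x
    using g(2) that by blast
  ultimately show ?thesis
    using that g(1) by blast
qed

lemma power_Gcd_eq_1:
  fixes c :: "'b::field"
  assumes "finite N" "\<And>n. n \<in> N \<Longrightarrow> c ^ n = 1"
  shows "c ^ Gcd N = 1"
  using assms
proof (induction N)
  case (insert n N)
  \<comment> \<open>Bezout in a form without subtraction, which requires \<open>a\<close> to be
    nonzero.\<close>
  have gcd: "c ^ gcd a b = 1" if "c ^ a = 1" "c ^ b = 1" for a b
  proof (cases "a = 0")
    case False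
    then obtain x y where "a * x = b * y + gcd a b" using bezout_nat by blast
    then have "(c ^ a) ^ x = (c ^ b) ^ y * c ^ gcd a b"
      by (simp flip: power_mult power_add)
    then show ?thesis using that by simp
  qed (use that in simp)
  then show ?case using insert by simp
qed simp

section \<open>Weighted orbits\<close>

lemma wact_wact: "wact w l (wact w m x) = wact w (l * m) x"
  by (simp add: wact_def fun_eq_iff power_mult_distrib mult.assoc)

lemma wact_1 [simp]: "wact w 1 x = x"
  by (simp add: wact_def)

lemma worbitI: "l \<noteq> 0 \<Longrightarrow> wact w l x \<in> worbit w x"
  by (auto simp: worbit_def)

lemma worbit_self: "x \<in> worbit w x"
  using worbitI[of 1 w x] by simp

lemma worbit_wact: "l \<noteq> 0 \<Longrightarrow> worbit w (wact w l x) = worbit w x"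
proof -
  assume l: "l \<noteq> 0"
  have "wact w m x \<in> worbit w (wact w l x)" if "m \<noteq> 0" for m
    using worbitI[of "m / l" w "wact w l x"] l that by (simp add: wact_wact)
  moreover have "wact w m (wact w l x) \<in> worbit w x" if "m \<noteq> 0" for m
    using worbitI[of "m * l" w x] l that by (simp add: wact_wact)
  ultimately show ?thesis
    unfolding worbit_def[of w "wact w l x"] worbit_def[of w x] by blast
qed

text \<open>Lang's argument for the multiplicative group: Frobenius moves \<open>z\<close> by some
  \<open>l\<close>, and rescaling \<open>z\<close> by a solution \<open>m\<close> of
  \<open>m ^ (q - 1) = inverse l\<close> makes every coordinate Frobenius-invariant.\<close>

lemma rational_point_has_representative:
  assumes "P \<in> rational_points w"
  obtains x :: "'n \<Rightarrow> 'a::{field,finite}" where "x \<noteq> (\<lambda>_. 0)" "P = worbit w (\<lambda>i. to_ac (x i))"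
proof -
  let ?q = "CARD('a)"
  obtain z where z: "P = worbit w z" "z \<noteq> (\<lambda>_. 0)" "frobenius ` P = P"
    using assms by (auto simp: rational_points_def geometric_points_def)
  then have "frobenius z \<in> worbit w z"
    using worbit_self[of z w] by blast
  then obtain l where l: "l \<noteq> 0" "frobenius z = wact w l z"
    by (auto simp: worbit_def)
  have "?q - 1 > 0" using CARD_field_gt_1[where 'a = 'a] by simp
  then obtain m where m: "m ^ (?q - 1) = inverse l"
    using nth_root_exists by blast
  have "m \<noteq> 0" using m l(1) \<open>?q - 1 > 0\<close> by (auto simp: power_0_left)
  have "m ^ ?q = m ^ (?q - 1) * m"
    using CARD_field_gt_1[where 'a = 'a] power_minus_mult[of ?q m] by simp
  then have ml: "m ^ ?q * l = m" using m l(1) by simp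
  have "wact w m z i \<in> range to_ac" for i
  proof (rule fixed_by_frobenius)
    have "z i ^ ?q = l ^ w i * z i"
      using l(2) by (simp add: frobenius_def wact_def fun_eq_iff)
    moreover have "(m ^ w i) ^ ?q = (m ^ ?q) ^ w i"
      by (metis power_mult mult.commute)
    ultimately have "wact w m z i ^ ?q = (m ^ ?q * l) ^ w i * z i"
      by (simp add: wact_def power_mult_distrib mult.assoc)
    then show "wact w m z i ^ ?q = wact w m z i"
      by (simp add: ml wact_def)
  qed
  then obtain x where x: "\<And>i. wact w m z i = to_ac (x i)"
    using that[of "\<lambda>i. of_ac (wact w m z i)"] by (simp add: to_ac_of_ac)
  then have "wact w m z = (\<lambda>i. to_ac (x i))" by auto
  then have "P = worbit w (\<lambda>i. to_ac (x i))"
    using worbit_wact[OF \<open>m \<noteq> 0\<close>, of w z] z(1) by simp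
  moreover have "x \<noteq> (\<lambda>_. 0)"
  proof
    assume "x = (\<lambda>_. 0)"
    then have "m ^ w i * z i = 0" for i
      using x[of i] by (simp add: wact_def)
    then show False using z(2) \<open>m \<noteq> 0\<close> by (simp add: fun_eq_iff)
  qed
  ultimately show ?thesis using that by blast
qed

section \<open>Representatives and orbits relative to a fixed base vector\<close>

locale weighted_point =
  fixes w :: "'n::finite \<Rightarrow> nat" and x0 :: "'n \<Rightarrow> 'a::{field,finite}" and k :: nat
  assumes w_pos: "\<And>i. w i > 0"
    and x0_nonzero: "x0 \<noteq> (\<lambda>_. 0)"
    and k_def: "k = Gcd (w ` {i. x0 i \<noteq> 0})"
begin

text \<open>The quotient \<open>w i div k\<close> is exact on the support of \<open>x0\<close>;
  elsewhere it may be truncated, but there the coordinates of the vectors concerned are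
  zero.\<close>

definition scale :: "'a \<Rightarrow> ('n \<Rightarrow> 'a) \<Rightarrow> ('n \<Rightarrow> 'a)" where
  "scale c x = (\<lambda>i. c ^ (w i div k) * x i)"

definition Orb :: "'a \<Rightarrow> ('n \<Rightarrow> 'a) set" where
  "Orb a = worbit w (scale a x0)"

abbreviation P :: "('n \<Rightarrow> 'a alg_closure) set" where
  "P \<equiv> worbit w (\<lambda>i. to_ac (x0 i))"

lemma k_dvd: "x0 i \<noteq> 0 \<Longrightarrow> k dvd w i"
  unfolding k_def by (rule Gcd_dvd) auto

lemma k_pos: "k > 0"
proof -
  obtain i where "x0 i \<noteq> 0" using x0_nonzero by auto
  then show ?thesis using k_dvd[of i] w_pos[of i] by (auto intro: Nat.gr0I)
qed

lemma Gcd_div_k: "Gcd ((\<lambda>i. w i div k) ` {i. x0 i \<noteq> 0}) = 1"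
proof -
  have "w ` {i. x0 i \<noteq> 0} = (*) k ` ((\<lambda>i. w i div k) ` {i. x0 i \<noteq> 0})"
    using k_dvd by (force simp: image_image)
  then have "k = k * Gcd ((\<lambda>i. w i div k) ` {i. x0 i \<noteq> 0})"
    using k_def Gcd_mult[of k "(\<lambda>i. w i div k) ` {i. x0 i \<noteq> 0}"] by simp
  then show ?thesis using k_pos by simp
qed

lemma power_w: "x0 i \<noteq> 0 \<Longrightarrow> (l::'b::monoid_mult) ^ w i = (l ^ k) ^ (w i div k)"
  using k_dvd[of i] by (simp flip: power_mult)

lemma scale_scale: "scale a (scale b x) = scale (a * b) x"
  by (simp add: scale_def power_mult_distrib mult.assoc)

lemma scale_1 [simp]: "scale 1 x = x"
  by (simp add: scale_def)

lemma wact_scale: "wact w l (scale a x0) = scale (a * l ^ k) x0"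
  using power_w[of _ l] by (fastforce simp: wact_def scale_def power_mult_distrib mult_ac)

text \<open>Equality makes all powers of \<open>a / b\<close> with exponents
  \<open>w i div k\<close>, over the support, equal to 1, and these exponents are coprime.\<close>

lemma scale_inj:
  assumes "a \<noteq> 0" "b \<noteq> 0" "scale a x0 = scale b x0"
  shows "a = b"
proof -
  have "(a / b) ^ (w i div k) = 1" if "x0 i \<noteq> 0" for i
    using fun_cong[OF assms(3), of i] that assms(2) by (simp add: scale_def power_divide)
  then have "(a / b) ^ Gcd ((\<lambda>i. w i div k) ` {i. x0 i \<noteq> 0}) = 1"
    by (intro power_Gcd_eq_1) auto
  then show ?thesis
    using assms(2) by (simp add: Gcd_div_k del: Gcd_image_normalize)
qed

lemma mem_Orb: "y \<in> Orb a \<longleftrightarrow> (\<exists>l. l \<noteq> 0 \<and> y = scale (a * l ^ k) x0)"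
  by (auto simp: Orb_def worbit_def wact_scale)

lemma Orb_eq_iff:
  assumes "a \<noteq> 0" "b \<noteq> 0"
  shows "Orb a = Orb b \<longleftrightarrow> (\<exists>l. l \<noteq> 0 \<and> a = b * l ^ k)"
proof
  assume "Orb a = Orb b"
  then have "scale a x0 \<in> Orb b"
    using worbit_self[of "scale a x0" w] by (simp add: Orb_def)
  then show "\<exists>l. l \<noteq> 0 \<and> a = b * l ^ k"
    using scale_inj[OF assms(1)] assms(2) unfolding mem_Orb by (metis mult_eq_0_iff power_eq_0_iff)
next
  assume "\<exists>l. l \<noteq> 0 \<and> a = b * l ^ k"
  then show "Orb a = Orb b"
    using worbit_wact unfolding Orb_def by (metis wact_scale)
qed

text \<open>A k-th root of \<open>c\<close> in the algebraic closure acts on the base vector exactly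
  as \<open>scale c\<close>.\<close>

lemma scale_in_P:
  assumes "c \<noteq> 0"
  shows "scale c x0 \<in> representatives P"
proof -
  obtain m where m: "m ^ k = to_ac c"
    using nth_root_exists[OF k_pos] by blast
  then have "m \<noteq> 0" using assms k_pos by (auto simp: power_0_left)
  have "wact w m (\<lambda>i. to_ac (x0 i)) = (\<lambda>i. to_ac (scale c x0 i))"
    using power_w[of _ m] by (fastforce simp: wact_def scale_def m)
  moreover have "scale c x0 \<noteq> (\<lambda>_. 0)"
    using x0_nonzero assms by (auto simp: scale_def fun_eq_iff)
  ultimately show ?thesis
    using worbitI[OF \<open>m \<noteq> 0\<close>, of w "\<lambda>i. to_ac (x0 i)"] by (simp add: representatives_def)
qed

text \<open>If \<open>l\<close> moves the base vector to another vector over the base field, then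
  \<open>l ^ w i\<close> is a nonzero scalar for \<open>i\<close> in the support. So all these
  weights, and hence their gcd \<open>k\<close>, annihilate \<open>l ^ (q - 1)\<close>; thus
  \<open>l ^ k\<close> is fixed by Frobenius and is the required scalar.\<close>

lemma representatives_P: "representatives P = {scale c x0 |c. c \<noteq> 0}"
proof (intro equalityI subsetI)
  fix x assume "x \<in> representatives P"
  then obtain l where l: "l \<noteq> 0" "(\<lambda>i. to_ac (x i)) = wact w l (\<lambda>i. to_ac (x0 i))"
    by (auto simp: representatives_def worbit_def)
  let ?q = "CARD('a)"
  have x: "to_ac (x i) = l ^ w i * to_ac (x0 i)" for i
    using fun_cong[OF l(2), of i] by (simp add: wact_def)
  have "(l ^ (?q - 1)) ^ n = 1" if n: "n \<in> w ` {i. x0 i \<noteq> 0}" for n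
  proof -
    obtain i where i: "n = w i" "x0 i \<noteq> 0" using n by auto
    have "l ^ w i = to_ac (x i / x0 i)" using x[of i] i(2) by simp
    moreover have "x i / x0 i \<noteq> 0" using x[of i] i(2) l(1) by force
    ultimately have "(l ^ w i) ^ (?q - 1) = to_ac ((x i / x0 i) ^ (?q - 1))"
      by (metis to_ac_power)
    also have "\<dots> = 1" using power_CARD_minus_1[OF \<open>x i / x0 i \<noteq> 0\<close>] by simp
    finally show ?thesis unfolding i(1) by (metis power_mult mult.commute)
  qed
  then have "(l ^ (?q - 1)) ^ k = 1"
    unfolding k_def by (intro power_Gcd_eq_1) auto
  then have "(l ^ k) ^ (?q - 1) = 1"
    by (metis power_mult mult.commute)
  then have "(l ^ k) ^ ?q = l ^ k"
    using CARD_field_gt_1[where 'a = 'a] power_minus_mult[of ?q "l ^ k"] by simp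
  then obtain d where d: "l ^ k = to_ac d" using fixed_by_frobenius by blast
  have "d \<noteq> 0" using d l(1) by force
  moreover have "x i = scale d x0 i" for i
  proof (cases "x0 i = 0")
    case True
    then show ?thesis using x[of i] by (simp add: scale_def)
  next
    case False
    then have "to_ac (x i) = to_ac (scale d x0 i)"
      using x[of i] by (simp add: scale_def power_w[of i l] d)
    then show ?thesis by simp
  qed
  ultimately show "x \<in> {scale c x0 |c. c \<noteq> 0}" by blast
qed (use scale_in_P in blast)

lemma rep_orbits_P: "rep_orbits w P = Orb ` {a. a \<noteq> 0}"
  unfolding rep_orbits_def representatives_P Orb_def by blast

lemma twist_P:
  assumes "a \<noteq> 0" "a0 \<noteq> 0"
  shows "twist w P (kummer_class k a) (Orb a0) = Orb (a * a0)"
proof -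
  have "y \<in> Orb (a * a0)"
    if x: "x \<in> Orb a0" and R: "fppf_cover R" "l \<in> Units R"
      and y: "\<And>i. emb R (y i) = (l [^]\<^bsub>R\<^esub> w i) \<otimes>\<^bsub>R\<^esub> emb R (x i)"
      and cl: "(R, cobd l) \<in> kummer_class k a" for x y R l
  proof -
    note R' = fppf_coverD[OF R(1)]
    interpret R: fq_algebra R by (rule R')
    obtain b where b: "b \<in> Units R" "b [^]\<^bsub>R\<^esub> k = emb R a"
      "\<And>T f g. fg_algebra T \<Longrightarrow> f \<in> alg_hom R T \<Longrightarrow> g \<in> alg_hom R T \<Longrightarrow> cobd l T f g = cobd b T f g"
      using cl by (rule kummer_classE) blast
    \<comment> \<open>The class determines \<open>l\<close> only up to a scalar \<open>c\<close>;
      this changes \<open>l ^ k\<close> by a k-th power, which does not move the orbit.\<close>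
    obtain c where c: "c \<noteq> 0" "l = emb R c \<otimes>\<^bsub>R\<^esub> b"
      using eq_cobd_unit_descends[OF R b(1,3)] by blast
    have lk: "l [^]\<^bsub>R\<^esub> k = emb R (a * c ^ k)"
      using b(1,2) by (simp add: c(2) R.nat_pow_distrib R.Units_closed R.emb_mult R.emb_power R.m_comm)
    obtain m where m: "m \<noteq> 0" "x = scale (a0 * m ^ k) x0"
      using x by (auto simp: mem_Orb)
    have "y i = scale (a * c ^ k) x i" for i
    proof -
      have "emb R (y i) = emb R (scale (a * c ^ k) x i)"
      \<comment> \<open>Off the support \<open>k\<close> need not divide the weight, but both sides
        vanish there.\<close>
      proof (cases "x0 i = 0")
        case True
        then have "x i = 0" by (simp add: m scale_def)
        then show ?thesis using y[of i] R(2) by (simp add: scale_def R.Units_closed)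
      next
        case False
        have "l [^]\<^bsub>R\<^esub> w i = (l [^]\<^bsub>R\<^esub> k) [^]\<^bsub>R\<^esub> (w i div k)"
          using k_dvd[OF False] R(2) by (simp add: R.nat_pow_pow R.Units_closed)
        then show ?thesis
          using y[of i] by (simp add: lk scale_def R.emb_mult R.emb_power)
      qed
      then show ?thesis using R.emb_eq_iff[OF R'(3)] by blast
    qed
    then have "y = scale (a * a0 * (c * m) ^ k) x0"
      unfolding m(2) scale_scale[symmetric] by (simp add: fun_eq_iff scale_def power_mult_distrib mult_ac)
    then show ?thesis
      unfolding mem_Orb using c(1) m(1) by (metis mult_eq_0_iff)
  qed
  moreover have "\<exists>x\<in>Orb a0. \<exists>R l. fppf_cover R \<and> l \<in> Units R \<and>
      (\<forall>i. emb R (y i) = (l [^]\<^bsub>R\<^esub> w i) \<otimes>\<^bsub>R\<^esub> emb R (x i)) \<and> (R, cobd l) \<in> kummer_class k a"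
    if yO: "y \<in> Orb (a * a0)" for y
  proof -
    obtain m where m: "m \<noteq> 0" "y = scale (a * a0 * m ^ k) x0"
      using yO by (auto simp: mem_Orb)
    obtain R :: "'a falg" and l where R: "fppf_cover R" "l \<in> Units R" "l [^]\<^bsub>R\<^esub> k = emb R a"
      using ex_kummer_cover[OF assms(1) k_pos] by blast
    interpret R: fq_algebra R by (rule fppf_coverD[OF R(1)])
    \<comment> \<open>The preimage of \<open>y\<close> under \<open>scale a\<close>; a k-th root of
      \<open>a\<close> over the covering carries it to \<open>y\<close>.\<close>
    define x where "x = scale (a0 * m ^ k) x0"
    have y: "y = scale a x" by (simp add: m(2) x_def scale_scale mult.assoc)
    have "emb R (y i) = (l [^]\<^bsub>R\<^esub> w i) \<otimes>\<^bsub>R\<^esub> emb R (x i)" for i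
    proof (cases "x0 i = 0")
      case True
      then have "x i = 0" by (simp add: x_def scale_def)
      then show ?thesis using R(2) by (simp add: y scale_def R.Units_closed)
    next
      case False
      have "l [^]\<^bsub>R\<^esub> w i = (l [^]\<^bsub>R\<^esub> k) [^]\<^bsub>R\<^esub> (w i div k)"
        using k_dvd[OF False] R(2) by (simp add: R.nat_pow_pow R.Units_closed)
      then show ?thesis
        by (simp add: y R(3) scale_def R.emb_mult R.emb_power)
    qed
    moreover have "x \<in> Orb a0" using m(1) by (auto simp: mem_Orb x_def)
    ultimately show ?thesis
      using R cobd_in_kummer_class[OF R] by blast
  qed
  moreover have "Orb a0 \<in> rep_orbits w P" using assms by (auto simp: rep_orbits_P)
  ultimately show ?thesis
    unfolding twist_def by auto
qed

lemma torsor_P: "torsor (H1_mu k :: ('a falg \<times> 'a cochain) set monoid) (rep_orbits w P) (twist w P)"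
proof -
  let ?G = "H1_mu k :: ('a falg \<times> 'a cochain) set monoid" and ?E = "rep_orbits w P"
  note carrier = carrier_H1_mu[OF k_pos]
  have bij: "twist w P (kummer_class k a) \<in> Bij ?E" if a: "a \<noteq> 0" for a
  proof -
    have "twist w P (kummer_class k a) (twist w P (kummer_class k b) A) = A"
      if A: "A \<in> ?E" and ab: "a \<noteq> 0" "b \<noteq> 0" "a * b = 1" for A a b
    proof -
      obtain a0 where "A = Orb a0" "a0 \<noteq> 0" using A by (auto simp: rep_orbits_P)
      moreover have "Orb (a * (b * a0)) = Orb a0" by (simp add: ab(3) flip: mult.assoc)
      ultimately show ?thesis using ab(1,2) by (simp only: twist_P mult_eq_0_iff simp_thms)
    qed
    moreover have "twist w P (kummer_class k b) A \<in> ?E" if "A \<in> ?E" "b \<noteq> 0" for A b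
      using that by (auto simp: rep_orbits_P twist_P)
    ultimately have "bij_betw (twist w P (kummer_class k a)) ?E ?E"
      using a by (intro bij_betwI[of _ _ _ "twist w P (kummer_class k (inverse a))"]) auto
    moreover have "twist w P (kummer_class k a) \<in> extensional ?E"
      by (simp add: twist_def)
    ultimately show ?thesis by (simp add: Bij_def)
  qed
  have hom: "twist w P \<in> hom ?G (BijGroup ?E)"
  proof (rule homI)
    show "twist w P c \<in> carrier (BijGroup ?E)" if "c \<in> carrier ?G" for c
      using that bij by (auto simp: carrier BijGroup_def)
    fix c d assume "c \<in> carrier ?G" "d \<in> carrier ?G"
    then obtain a b where ab: "c = kummer_class k a" "d = kummer_class k b" "a \<noteq> 0" "b \<noteq> 0"
      by (auto simp: carrier)
    \<comment> \<open>The action is a homomorphism to \<open>BijGroup\<close>, so the functions must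
      agree everywhere; off the orbits both are \<open>undefined\<close>.\<close>
    have "twist w P (c \<otimes>\<^bsub>?G\<^esub> d) A = compose ?E (twist w P c) (twist w P d) A" for A
    proof (cases "A \<in> ?E")
      case True
      then obtain a0 where "A = Orb a0" "a0 \<noteq> 0" by (auto simp: rep_orbits_P)
      then show ?thesis
        using ab True by (simp add: H1_mu_mult k_pos twist_P compose_def mult.assoc)
    qed (simp add: compose_def twist_def)
    then show "twist w P (c \<otimes>\<^bsub>?G\<^esub> d) = twist w P c \<otimes>\<^bsub>BijGroup ?E\<^esub> twist w P d"
      using bij ab by (auto simp: BijGroup_def)
  qed
  have "group_action ?G ?E (twist w P)"
    unfolding group_action_def group_hom_def group_hom_axioms_def
    using group_H1_mu[OF k_pos] group_BijGroup hom by blast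
  moreover have "?E \<noteq> {}"
    unfolding rep_orbits_P by (auto intro: exI[of _ 1])
  moreover have "\<exists>!g. g \<in> carrier ?G \<and> twist w P g A = B" if AB: "A \<in> ?E" "B \<in> ?E" for A B
  proof -
    obtain a b where ab: "A = Orb a" "B = Orb b" "a \<noteq> 0" "b \<noteq> 0"
      using AB by (auto simp: rep_orbits_P)
    show ?thesis
    \<comment> \<open>The orbit of parameter \<open>a\<close> is carried to that of parameter
      \<open>b\<close> by the ratio, which is determined up to k-th powers and so has a well-defined
      Kummer class.\<close>
    proof (rule ex1I[of _ "kummer_class k (b / a)"])
      show "kummer_class k (b / a) \<in> carrier ?G \<and> twist w P (kummer_class k (b / a)) A = B"
        using ab by (auto simp: carrier twist_P)
      fix g assume g: "g \<in> carrier ?G \<and> twist w P g A = B"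
      then obtain c where c: "g = kummer_class k c" "c \<noteq> 0" by (auto simp: carrier)
      then have "Orb (c * a) = Orb b" using g ab by (simp add: twist_P)
      then obtain l where "l \<noteq> 0" "c * a = b * l ^ k"
        using Orb_eq_iff[of "c * a" b] ab c(2) by auto
      then have "l \<noteq> 0" "c = b / a * l ^ k" using ab(3) by (simp_all add: field_simps)
      then show "g = kummer_class k (b / a)"
        using kummer_class_eq_iff[of c "b / a" k] ab c k_pos by auto
    qed
  qed
  ultimately show ?thesis by (simp add: torsor_def)
qed

lemma card_P: "card (rep_orbits w P) = gcd k (CARD('a) - 1)"
proof -
  let ?n = "CARD('a) - 1"
  define d where "d = gcd k ?n"
  have "d > 0" using k_pos by (simp add: d_def)
  obtain g :: 'a where g: "g \<noteq> 0" "\<And>x. x \<noteq> 0 \<Longrightarrow> \<exists>i. x = g ^ i"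
    and cong: "\<And>i j. g ^ i = g ^ j \<longleftrightarrow> [i = j] (mod ?n)"
    by (rule ex_primitive_element) blast
  \<comment> \<open>A multiple of \<open>d = gcd k (q - 1)\<close> is congruent to a multiple of
    \<open>k\<close> modulo \<open>q - 1\<close>, so the corresponding power of \<open>g\<close> is
    a k-th power and exponents matter only modulo \<open>d\<close>.\<close>
  have "Orb (g ^ i) = Orb (g ^ (i mod d))" for i
  proof -
    obtain t where "[k * t = d * (i div d)] (mod ?n)"
      using cong_solve_dvd_nat[of k ?n "d * (i div d)"] by (auto simp: d_def)
    then have "g ^ (d * (i div d)) = (g ^ t) ^ k"
      using cong[of "d * (i div d)" "t * k"] by (simp add: cong_sym_eq mult.commute flip: power_mult)
    moreover have "g ^ i = g ^ (i mod d) * g ^ (d * (i div d))"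
      by (simp flip: power_add)
    ultimately show ?thesis
      using g(1) by (subst Orb_eq_iff) (auto intro!: exI[of _ "g ^ t"])
  qed
  moreover have "\<exists>i. a = g ^ i" if "a \<noteq> 0" for a using g(2)[OF that] .
  ultimately have "rep_orbits w P = (\<lambda>i. Orb (g ^ i)) ` {0..<d}"
    unfolding rep_orbits_P using g(1) \<open>d > 0\<close>
    by (auto simp: image_iff) (metis atLeastLessThan_iff mod_less_divisor zero_le)
  \<comment> \<open>Since \<open>d\<close> divides both \<open>q - 1\<close> and \<open>k\<close>,
    reducing the congruence of exponents modulo \<open>d\<close> removes the contribution of the
    k-th power.\<close>
  moreover have "inj_on (\<lambda>i. Orb (g ^ i)) {0..<d}"
  proof (rule inj_onI)
    fix i j assume ij: "i \<in> {0..<d}" "j \<in> {0..<d}" "Orb (g ^ i) = Orb (g ^ j)"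
    then obtain l where l: "l \<noteq> 0" "g ^ i = g ^ j * l ^ k"
      using Orb_eq_iff[of "g ^ i" "g ^ j"] g(1) by auto
    obtain t where "l = g ^ t" using g(2)[OF l(1)] by blast
    then have "g ^ i = g ^ (j + t * k)"
      using l(2) by (simp add: power_add power_mult)
    then have "[i = j + t * k] (mod d)"
      unfolding cong by (rule cong_dvd_modulus_nat) (simp add: d_def)
    moreover have "[j + t * k = j + 0] (mod d)"
      by (intro cong_add) (auto simp: cong_0_iff d_def)
    ultimately have "[i = j] (mod d)"
      using cong_trans by fastforce
    then show "i = j" using ij by (simp add: cong_def)
  qed
  ultimately show ?thesis
    by (simp add: card_image d_def)
qed

lemma support_P: "support P = {i. x0 i \<noteq> 0}"
proof -
  have "(\<exists>x\<in>P. x i \<noteq> 0) \<longleftrightarrow> x0 i \<noteq> 0" for i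
    using worbit_self[of "\<lambda>i. to_ac (x0 i)" w] by (force simp: worbit_def wact_def)
  then show ?thesis by (simp add: support_def)
qed

end

theorem proposition3p7:
  fixes w :: "'n::finite \<Rightarrow> nat"
    and P :: "('n \<Rightarrow> 'a::{field,finite} alg_closure) set"
    and k :: nat
  assumes "\<And>i. w i > 0"
    and "P \<in> rational_points w"
    and "k = Gcd (w ` support P)"
  shows "torsor (H1_mu k) (rep_orbits w P) (twist w P) \<and>
         card (rep_orbits w P) = gcd k (CARD('a) - 1)"
proof -
  obtain x :: "'n \<Rightarrow> 'a" where x: "x \<noteq> (\<lambda>_. 0)" "P = worbit w (\<lambda>i. to_ac (x i))"
    using rational_point_has_representative[OF assms(2)] .
  have "weighted_point w x (Gcd (w ` {i. x i \<noteq> 0}))"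
    using assms(1) x(1) by (simp add: weighted_point_def)
  then interpret weighted_point w x "Gcd (w ` {i. x i \<noteq> 0})" .
  show ?thesis
    using torsor_P card_P support_P by (simp add: assms(3) x(2))
qed

end
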